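(* Let $\mathcal I$ be an ideal on $\mathbb N$, $(\mathcal I_n)_{n\in\mathbb N}$ a sequence of proper ideals on $\mathbb N$, and $X$ a Banach lattice. Then $$\ell_\infty(X)/c_{0,\sum_{\mathcal I}\mathcal I_n}(X)\ \equiv_{\le}\ \ell_\infty\big((\ell_\infty(X)/c_{0,\mathcal I_n}(X))_n\big)\Big/ c_{0,\mathcal I}\big((\ell_\infty(X)/c_{0,\mathcal I_n}(X))_n\big),$$ where on the left-hand side $\ell_\infty(X)$ is the space of bounded families in $X$ indexed by $\mathbb N\times\mathbb N$. In particular, if $\mathcal I_n=\mathcal J$ for all $n\in\mathbb N$, then $$\ell_\infty(X)/c_{0,\mathcal I\times\mathcal J}(X)\ \equiv_{\le}\ \ell_\infty\big(\ell_\infty(X)/c_{0,\mathcal J}(X)\big)\Big/ c_{0,\mathcal I}\big(\ell_\infty(X)/c_{0,\mathcal J}(X)\big).$$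
   Context: Banach lattices are real. An ideal on a countable set $F$ is a collection of subsets of $F$ containing $\emptyset$, closed under subsets and finite unions; every ideal is assumed to contain all finite sets; it is proper if it is not $\mathcal P(F)$. $\ell_\infty(X)$ (over $F$) is the Banach lattice of bounded families $(x_n)_{n\in F}$ in $X$ with sup norm and coordinatewise order, and $c_{0,\mathcal I}(X)$ is its closed lattice ideal of all $(x_n)$ with $\{n\in F:\|x_n\|\ge\varepsilon\}\in\mathcal I$ for every $\varepsilon>0$. For Banach lattices $(Z_n)_{n\in\mathbb N}$, $\ell_\infty((Z_n)_n)$ is the Banach lattice of all bounded $(z_n)\in\prod_nZ_n$ with norm $\sup_n\|z_n\|$ and coordinatewise order, and $c_{0,\mathcal I}((Z_n)_n)$ is its closed lattice ideal of all $(z_n)$ with $\{n:\|z_n\|\ge\varepsilon\}\in\mathcal I$ for every $\varepsilon>0$. Quotients by closed lattice ideals carry the quotient norm and quotient lattice structure. The Frolík sum is $\sum_{\mathcal I}\mathcal I_n=\{A\subseteq\mathbb N\times\mathbb N:\{m\in\mathbb N:A_{(m)}\notin\mathcal I_m\}\in\mathcal I\}$, where $A_{(m)}=\{n:(m,n)\in A\}$; when $\mathcal I_m=\mathcal J$ for all $m$ it is the Fubini product $\mathcal I\times\mathcal J$. $E\equiv_{\le}G$ means there is a surjective linear isometry $E\to G$ that is a lattice isomorphism. *)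

theory Defs
  imports Complex_Main "HOL-Library.Countable" "HOL-Algebra.Lattice" "HOL-Algebra.Group"
begin

section \<open>Banach lattices with explicit carrier\<close>

text \<open>
  The quotients \<open>l\<^sub>\<infinity>(X) / c\<^sub>0\<close> below depend on an ideal, hence cannot be types, so
  normed vector lattices are records on an explicit carrier. They extend the order structures of
  HOL-Algebra; the lattice operations \<open>x \<squnion>\<^bsub>E\<^esub> y\<close> and \<open>x \<sqinter>\<^bsub>E\<^esub> y\<close> are the ones
  derived there from the order \<open>x \<sqsubseteq>\<^bsub>E\<^esub> y\<close>.
\<close>

record 'a normed_vlat = "'a gorder" +
  vzero :: 'a  (\<open>\<zero>\<index>\<close>)
  vadd :: "'a \<Rightarrow> 'a \<Rightarrow> 'a"  (infixl \<open>\<oplus>\<index>\<close> 65)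
  vscale :: "real \<Rightarrow> 'a \<Rightarrow> 'a"  (infixr \<open>\<odot>\<index>\<close> 75)
  vnorm :: "'a \<Rightarrow> real"

locale banach_lattice = lattice E for E :: "'a normed_vlat" (structure) +
  assumes add_comm_group:
      "comm_group \<lparr>carrier = carrier E, mult = vadd E, one = vzero E\<rparr>"
    and scale_closed: "x \<in> carrier E \<Longrightarrow> a \<odot> x \<in> carrier E"
    and scale_one: "x \<in> carrier E \<Longrightarrow> 1 \<odot> x = x"
    and scale_scale: "x \<in> carrier E \<Longrightarrow> a \<odot> (b \<odot> x) = (a * b) \<odot> x"
    and scale_add_left: "x \<in> carrier E \<Longrightarrow> (a + b) \<odot> x = a \<odot> x \<oplus> b \<odot> x"
    and scale_add_right:
      "\<lbrakk>x \<in> carrier E; y \<in> carrier E\<rbrakk> \<Longrightarrow> a \<odot> (x \<oplus> y) = a \<odot> x \<oplus> a \<odot> y"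
    and add_mono:
      "\<lbrakk>x \<in> carrier E; y \<in> carrier E; z \<in> carrier E; x \<sqsubseteq> y\<rbrakk> \<Longrightarrow> x \<oplus> z \<sqsubseteq> y \<oplus> z"
    and scale_mono:
      "\<lbrakk>x \<in> carrier E; y \<in> carrier E; 0 \<le> a; x \<sqsubseteq> y\<rbrakk> \<Longrightarrow> a \<odot> x \<sqsubseteq> a \<odot> y"
    and norm_eq_zero: "x \<in> carrier E \<Longrightarrow> vnorm E x = 0 \<longleftrightarrow> x = \<zero>"
    and norm_scale: "x \<in> carrier E \<Longrightarrow> vnorm E (a \<odot> x) = \<bar>a\<bar> * vnorm E x"
    and norm_triangle:
      "\<lbrakk>x \<in> carrier E; y \<in> carrier E\<rbrakk> \<Longrightarrow> vnorm E (x \<oplus> y) \<le> vnorm E x + vnorm E y"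
    and norm_lattice:
      "\<lbrakk>x \<in> carrier E; y \<in> carrier E; x \<squnion> (- 1) \<odot> x \<sqsubseteq> y \<squnion> (- 1) \<odot> y\<rbrakk>
        \<Longrightarrow> vnorm E x \<le> vnorm E y"
    and complete:
      "\<lbrakk>\<And>n. s n \<in> carrier E;
        \<And>\<epsilon>. 0 < \<epsilon> \<Longrightarrow> \<exists>N. \<forall>m\<ge>N. \<forall>n\<ge>N. vnorm E (s m \<oplus> (- 1) \<odot> s n) < \<epsilon>\<rbrakk>
        \<Longrightarrow> \<exists>l\<in>carrier E. (\<lambda>n. vnorm E (s n \<oplus> (- 1) \<odot> l)) \<longlonglongrightarrow> 0"

definition lattice_isometric :: "'a normed_vlat \<Rightarrow> 'b normed_vlat \<Rightarrow> bool"
    (infix \<open>\<equiv>\<^sub>\<le>\<close> 50) where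
  "E \<equiv>\<^sub>\<le> G \<longleftrightarrow>
    (\<exists>T. bij_betw T (carrier E) (carrier G) \<and>
      (\<forall>x\<in>carrier E. \<forall>y\<in>carrier E. T (x \<oplus>\<^bsub>E\<^esub> y) = T x \<oplus>\<^bsub>G\<^esub> T y) \<and>
      (\<forall>a. \<forall>x\<in>carrier E. T (a \<odot>\<^bsub>E\<^esub> x) = a \<odot>\<^bsub>G\<^esub> T x) \<and>
      (\<forall>x\<in>carrier E. vnorm G (T x) = vnorm E x) \<and>
      join_pres E G T \<and> meet_pres E G T)"

definition coset :: "'a normed_vlat \<Rightarrow> 'a set \<Rightarrow> 'a \<Rightarrow> 'a set" where
  "coset E J x = (\<lambda>j. x \<oplus>\<^bsub>E\<^esub> j) ` J"

text \<open>
  Quotient by a closed lattice ideal \<open>J\<close>. The order is the one whose positive cone is the image of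
  the positive cone of \<open>E\<close>. The unions defining the operations collapse to a single coset, since
  the coset of the result does not depend on the representatives; note that the pointwise multiple
  of a coset by 0 would be the set containing 0 only, and not \<open>J\<close>.
\<close>

definition quot :: "'a normed_vlat \<Rightarrow> 'a set \<Rightarrow> 'a set normed_vlat"  (infixl \<open>'/'/\<^sub>q\<close> 70) where
  "E //\<^sub>q J =
    \<lparr>carrier = coset E J ` carrier E,
     eq = (=),
     le = (\<lambda>A B. \<exists>a\<in>A. \<exists>b\<in>B. a \<sqsubseteq>\<^bsub>E\<^esub> b),
     vzero = coset E J \<zero>\<^bsub>E\<^esub>,
     vadd = (\<lambda>A B. \<Union>a\<in>A. \<Union>b\<in>B. coset E J (a \<oplus>\<^bsub>E\<^esub> b)),
     vscale = (\<lambda>c A. \<Union>a\<in>A. coset E J (c \<odot>\<^bsub>E\<^esub> a)),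
     vnorm = (\<lambda>A. INF a\<in>A. vnorm E a)\<rparr>"


section \<open>Ideals of sets and the associated sequence spaces\<close>

text \<open>
  The countable index set is rendered as a type. As usual for ideals on a countable set, all
  finite sets are required to belong to the ideal.
\<close>

definition set_ideal :: "'i::countable set set \<Rightarrow> bool" where
  "set_ideal I \<longleftrightarrow>
    {} \<in> I \<and> (\<forall>A\<in>I. \<forall>B. B \<subseteq> A \<longrightarrow> B \<in> I) \<and> (\<forall>A\<in>I. \<forall>B\<in>I. A \<union> B \<in> I) \<and>
    (\<forall>A. finite A \<longrightarrow> A \<in> I)"

definition proper_ideal :: "'i::countable set set \<Rightarrow> bool" where
  "proper_ideal I \<longleftrightarrow> set_ideal I \<and> I \<noteq> Pow UNIV"

definition frolik_sum :: "nat set set \<Rightarrow> (nat \<Rightarrow> nat set set) \<Rightarrow> (nat \<times> nat) set set" where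
  "frolik_sum I Is = {A. {m. {n. (m, n) \<in> A} \<notin> Is m} \<in> I}"

definition fubini_product :: "nat set set \<Rightarrow> nat set set \<Rightarrow> (nat \<times> nat) set set" where
  "fubini_product I J = frolik_sum I (\<lambda>_. J)"

text \<open>
  For a family \<open>Z\<close> of Banach lattices, \<open>linf Z\<close> is \<open>l\<^sub>\<infinity>((Z\<^sub>i)\<^sub>i)\<close> and \<open>c0 I Z\<close> its closed lattice
  ideal \<open>c\<^sub>0\<^sub>,\<^sub>I((Z\<^sub>i)\<^sub>i)\<close>; the spaces \<open>l\<^sub>\<infinity>(X)\<close> and \<open>c\<^sub>0\<^sub>,\<^sub>I(X)\<close> are the case of a constant family.
\<close>

definition linf :: "('i::countable \<Rightarrow> 'a normed_vlat) \<Rightarrow> ('i \<Rightarrow> 'a) normed_vlat" where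
  "linf Z =
    \<lparr>carrier = {z. (\<forall>i. z i \<in> carrier (Z i)) \<and> bdd_above (range (\<lambda>i. vnorm (Z i) (z i)))},
     eq = (=),
     le = (\<lambda>x y. \<forall>i. x i \<sqsubseteq>\<^bsub>Z i\<^esub> y i),
     vzero = (\<lambda>i. \<zero>\<^bsub>Z i\<^esub>),
     vadd = (\<lambda>x y i. x i \<oplus>\<^bsub>Z i\<^esub> y i),
     vscale = (\<lambda>a x i. a \<odot>\<^bsub>Z i\<^esub> x i),
     vnorm = (\<lambda>z. SUP i. vnorm (Z i) (z i))\<rparr>"

definition c0 :: "'i::countable set set \<Rightarrow> ('i \<Rightarrow> 'a normed_vlat) \<Rightarrow> ('i \<Rightarrow> 'a) set" where
  "c0 I Z = {z \<in> carrier (linf Z). \<forall>\<epsilon>>0. {i. vnorm (Z i) (z i) \<ge> \<epsilon>} \<in> I}"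

end

theory Submission
  imports Defs
begin

text \<open>
  The norm of the class of \<open>x\<close> in \<open>l\<^sub>\<infinity>(X) / c\<^sub>0\<^sub>,\<^sub>I(X)\<close> is the limes superior of \<open>\<parallel>x\<^sub>i\<parallel>\<close> along the ideal:
  it is at most \<open>c \<ge> 0\<close> iff \<open>{i. \<parallel>x\<^sub>i\<parallel> \<ge> c + \<epsilon>}\<close> belongs to \<open>I\<close> for every \<open>\<epsilon> > 0\<close>. Send a bounded double
  family \<open>x\<close> to the class of the sequence of the classes of its rows. Unfolding the criterion twice,
  once for the rows and once for the sequence of row classes, gives precisely the criterion for the
  Frolik sum. Hence this map has the right kernel (the case \<open>c = 0\<close>) and is isometric
  on the quotient. It is a lattice homomorphism since classes and rows respect joins, and it is
  surjective since a bounded sequence of classes has a uniformly bounded sequence of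
  representatives.
\<close>

section \<open>Seminormed vector lattices\<close>

lemma latticeI:
  fixes E (structure)
  assumes "eq E = (=)"
    and "\<And>x. x \<in> carrier E \<Longrightarrow> x \<sqsubseteq> x"
    and "\<And>x y. \<lbrakk>x \<in> carrier E; y \<in> carrier E; x \<sqsubseteq> y; y \<sqsubseteq> x\<rbrakk> \<Longrightarrow> x = y"
    and "\<And>x y z. \<lbrakk>x \<in> carrier E; y \<in> carrier E; z \<in> carrier E; x \<sqsubseteq> y; y \<sqsubseteq> z\<rbrakk> \<Longrightarrow> x \<sqsubseteq> z"
    and join: "\<And>x y. \<lbrakk>x \<in> carrier E; y \<in> carrier E\<rbrakk> \<Longrightarrow>
      \<exists>s\<in>carrier E. x \<sqsubseteq> s \<and> y \<sqsubseteq> s \<and> (\<forall>u\<in>carrier E. x \<sqsubseteq> u \<longrightarrow> y \<sqsubseteq> u \<longrightarrow> s \<sqsubseteq> u)"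
    and meet: "\<And>x y. \<lbrakk>x \<in> carrier E; y \<in> carrier E\<rbrakk> \<Longrightarrow>
      \<exists>s\<in>carrier E. s \<sqsubseteq> x \<and> s \<sqsubseteq> y \<and> (\<forall>u\<in>carrier E. u \<sqsubseteq> x \<longrightarrow> u \<sqsubseteq> y \<longrightarrow> u \<sqsubseteq> s)"
  shows "lattice E"
proof -
  interpret partial_order E
  proof
    show "x \<sqsubseteq> z" if "x \<sqsubseteq> y" "y \<sqsubseteq> z" "x \<in> carrier E" "y \<in> carrier E" "z \<in> carrier E" for x y z
      using assms(4)[of x y z] that by simp
  qed (simp_all add: assms(1-3))
  show ?thesis
  proof
    fix x y assume xy: "x \<in> carrier E" "y \<in> carrier E"
    from join[OF xy] obtain s where "s \<in> carrier E" "x \<sqsubseteq> s" "y \<sqsubseteq> s"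
      and "\<forall>u\<in>carrier E. x \<sqsubseteq> u \<longrightarrow> y \<sqsubseteq> u \<longrightarrow> s \<sqsubseteq> u"
      by blast
    with xy have "least E s (Upper E {x, y})"
      by (simp add: least_def Upper_def)
    then show "\<exists>s. least E s (Upper E {x, y})" ..
    from meet[OF xy] obtain s where "s \<in> carrier E" "s \<sqsubseteq> x" "s \<sqsubseteq> y"
      and "\<forall>u\<in>carrier E. u \<sqsubseteq> x \<longrightarrow> u \<sqsubseteq> y \<longrightarrow> u \<sqsubseteq> s"
      by blast
    with xy have "greatest E s (Lower E {x, y})"
      by (simp add: greatest_def Lower_def)
    then show "\<exists>s. greatest E s (Lower E {x, y})" ..
  qed
qed

lemma (in lattice) join_eqI:
  assumes "x \<in> carrier L" "y \<in> carrier L" "s \<in> carrier L" "x \<sqsubseteq> s" "y \<sqsubseteq> s"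
    and "\<And>u. \<lbrakk>u \<in> carrier L; x \<sqsubseteq> u; y \<sqsubseteq> u\<rbrakk> \<Longrightarrow> s \<sqsubseteq> u"
  shows "x \<squnion> y = s"
  using assms by (intro le_antisym join_le join_closed assms(6)) (simp_all add: join_left join_right)

lemma (in lattice) meet_eqI:
  assumes "x \<in> carrier L" "y \<in> carrier L" "s \<in> carrier L" "s \<sqsubseteq> x" "s \<sqsubseteq> y"
    and "\<And>u. \<lbrakk>u \<in> carrier L; u \<sqsubseteq> x; u \<sqsubseteq> y\<rbrakk> \<Longrightarrow> u \<sqsubseteq> s"
  shows "x \<sqinter> y = s"
  using assms by (intro le_antisym meet_le meet_closed assms(6)) (simp_all add: meet_left meet_right)

lemma (in lattice) le_iff_join_eq:
  assumes "x \<in> carrier L" "y \<in> carrier L"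
  shows "x \<sqsubseteq> y \<longleftrightarrow> x \<squnion> y = y"
  using assms by (metis join_eqI join_left le_refl)

text \<open>Since \<open>x \<sqsubseteq> y\<close> holds iff the join of \<open>x\<close> and
  \<open>y\<close> is \<open>y\<close>, an injective map that respects joins both preserves and
  reflects the order. Being onto as well, it is an order isomorphism and must carry greatest lower
  bounds to greatest lower bounds. Later constructions therefore only have to verify joins.\<close>

lemma join_iso_meet_pres:
  assumes E: "lattice E" and G: "lattice G"
    and bij: "bij_betw T (carrier E) (carrier G)"
    and join: "\<And>x y. \<lbrakk>x \<in> carrier E; y \<in> carrier E\<rbrakk> \<Longrightarrow> T (x \<squnion>\<^bsub>E\<^esub> y) = T x \<squnion>\<^bsub>G\<^esub> T y"
  shows "meet_pres E G T"
proof -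
  interpret E: lattice E by fact
  interpret G: lattice G by fact
  have T: "T x \<in> carrier G" if "x \<in> carrier E" for x
    using bij that by (auto simp: bij_betw_def)
  have le: "T x \<sqsubseteq>\<^bsub>G\<^esub> T y \<longleftrightarrow> x \<sqsubseteq>\<^bsub>E\<^esub> y" if "x \<in> carrier E" "y \<in> carrier E" for x y
    using that T bij
    by (simp add: E.le_iff_join_eq G.le_iff_join_eq flip: join)
      (metis E.join_closed bij_betw_imp_inj_on inj_onD)
  have "T x \<sqinter>\<^bsub>G\<^esub> T y = T (x \<sqinter>\<^bsub>E\<^esub> y)" if xy: "x \<in> carrier E" "y \<in> carrier E" for x y
  proof (rule G.meet_eqI)
    fix u assume u: "u \<in> carrier G" "u \<sqsubseteq>\<^bsub>G\<^esub> T x" "u \<sqsubseteq>\<^bsub>G\<^esub> T y"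
    obtain v where "v \<in> carrier E" "u = T v"
      using bij u(1) by (auto simp: bij_betw_def)
    with u xy show "u \<sqsubseteq>\<^bsub>G\<^esub> T (x \<sqinter>\<^bsub>E\<^esub> y)"
      by (simp add: le E.meet_le)
  qed (use xy in \<open>simp_all add: T le E.meet_left E.meet_right\<close>)
  then show ?thesis
    using E G by (simp add: meet_pres_def)
qed

section \<open>The modulus and its interplay with the norm\<close>

definition vabs :: "('a, 'b) normed_vlat_scheme \<Rightarrow> 'a \<Rightarrow> 'a" (\<open>vabs\<index> _\<close> [80] 80) where
  "vabs\<^bsub>E\<^esub> x = x \<squnion>\<^bsub>E\<^esub> ((- 1) \<odot>\<^bsub>E\<^esub> x)"

text \<open>
  Leaving out completeness and definiteness of the norm makes this class closed under quotients
  by all lattice ideals, so that quotients can be iterated without proofs of closedness.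
\<close>

locale seminormed_vlat = lattice E for E :: "'a normed_vlat" (structure) +
  assumes add_closed [simp]: "\<lbrakk>x \<in> carrier E; y \<in> carrier E\<rbrakk> \<Longrightarrow> x \<oplus> y \<in> carrier E"
    and zero_closed [simp]: "\<zero> \<in> carrier E"
    and scale_closed [simp]: "x \<in> carrier E \<Longrightarrow> a \<odot> x \<in> carrier E"
    and add_assoc: "\<lbrakk>x \<in> carrier E; y \<in> carrier E; z \<in> carrier E\<rbrakk> \<Longrightarrow> x \<oplus> y \<oplus> z = x \<oplus> (y \<oplus> z)"
    and add_comm: "\<lbrakk>x \<in> carrier E; y \<in> carrier E\<rbrakk> \<Longrightarrow> x \<oplus> y = y \<oplus> x"
    and add_zero [simp]: "x \<in> carrier E \<Longrightarrow> x \<oplus> \<zero> = x"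
    and scale_zero [simp]: "x \<in> carrier E \<Longrightarrow> 0 \<odot> x = \<zero>"
    and scale_one [simp]: "x \<in> carrier E \<Longrightarrow> 1 \<odot> x = x"
    and scale_scale [simp]: "x \<in> carrier E \<Longrightarrow> a \<odot> b \<odot> x = (a * b) \<odot> x"
    and scale_add_left: "x \<in> carrier E \<Longrightarrow> (a + b) \<odot> x = a \<odot> x \<oplus> b \<odot> x"
    and scale_add_right:
      "\<lbrakk>x \<in> carrier E; y \<in> carrier E\<rbrakk> \<Longrightarrow> a \<odot> (x \<oplus> y) = a \<odot> x \<oplus> a \<odot> y"
    and add_right_mono:
      "\<lbrakk>x \<in> carrier E; y \<in> carrier E; z \<in> carrier E; x \<sqsubseteq> y\<rbrakk> \<Longrightarrow> x \<oplus> z \<sqsubseteq> y \<oplus> z"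
    and scale_mono:
      "\<lbrakk>x \<in> carrier E; y \<in> carrier E; 0 \<le> a; x \<sqsubseteq> y\<rbrakk> \<Longrightarrow> a \<odot> x \<sqsubseteq> a \<odot> y"
    and norm_scale_le: "x \<in> carrier E \<Longrightarrow> vnorm E (a \<odot> x) \<le> \<bar>a\<bar> * vnorm E x"
    and norm_triangle:
      "\<lbrakk>x \<in> carrier E; y \<in> carrier E\<rbrakk> \<Longrightarrow> vnorm E (x \<oplus> y) \<le> vnorm E x + vnorm E y"
    and norm_lattice:
      "\<lbrakk>x \<in> carrier E; y \<in> carrier E; vabs x \<sqsubseteq> vabs y\<rbrakk> \<Longrightarrow> vnorm E x \<le> vnorm E y"

text \<open>The additive axioms come from the commutative group and most others are literally
  assumed. Only \<open>0 \<odot> x = \<zero>\<close> needs an argument: \<open>0 \<odot> x\<close>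
  is idempotent under addition, and a group has no other idempotent than its unit.\<close>

lemma (in banach_lattice) seminormed_vlat: "seminormed_vlat E"
proof -
  interpret G: comm_group "\<lparr>carrier = carrier E, mult = vadd E, one = vzero E\<rparr>"
    by (rule add_comm_group)
  have closed: "x \<oplus> y \<in> carrier E" if "x \<in> carrier E" "y \<in> carrier E" for x y
    using G.m_closed that by simp
  have zero: "0 \<odot> x = \<zero>" if x: "x \<in> carrier E" for x
  proof -
    have "0 \<odot> x \<oplus> 0 \<odot> x = 0 \<odot> x"
      using scale_add_left[OF x, of 0 0] by simp
    then show ?thesis
      using G.r_cancel_one[of "0 \<odot> x" "0 \<odot> x"] scale_closed[OF x] by simp
  qed
  show ?thesis
    using G.one_closed
    by unfold_locales
      (auto simp: vabs_def closed zero scale_closed scale_one scale_scale scale_add_left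
        scale_add_right add_mono scale_mono norm_scale norm_triangle norm_lattice
        intro: G.m_assoc[simplified] G.m_comm[simplified] G.r_one[simplified])
qed

context seminormed_vlat
begin

lemma add_left_comm:
  "\<lbrakk>x \<in> carrier E; y \<in> carrier E; z \<in> carrier E\<rbrakk> \<Longrightarrow> x \<oplus> (y \<oplus> z) = y \<oplus> (x \<oplus> z)"
  by (metis add_assoc add_comm)

lemmas add_ac = add_assoc add_comm add_left_comm

lemma zero_add [simp]: "x \<in> carrier E \<Longrightarrow> \<zero> \<oplus> x = x"
  by (simp add: add_comm)

lemma scale_zero_right [simp]: "a \<odot> \<zero> = \<zero>"
  by (metis mult_zero_right scale_scale scale_zero zero_closed)

lemma add_neg [simp]:
  assumes "x \<in> carrier E" shows "x \<oplus> (- 1) \<odot> x = \<zero>"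
  using scale_add_left[OF assms, of 1 "- 1"] assms by simp

lemma neg_add [simp]: "x \<in> carrier E \<Longrightarrow> (- 1) \<odot> x \<oplus> x = \<zero>"
  by (simp add: add_comm)

lemma add_neg_left [simp]:
  "\<lbrakk>x \<in> carrier E; y \<in> carrier E\<rbrakk> \<Longrightarrow> x \<oplus> ((- 1) \<odot> x \<oplus> y) = y"
  by (simp flip: add_assoc)

lemma neg_add_left [simp]:
  "\<lbrakk>x \<in> carrier E; y \<in> carrier E\<rbrakk> \<Longrightarrow> (- 1) \<odot> x \<oplus> (x \<oplus> y) = y"
  by (simp flip: add_assoc)

lemma add_mono:
  assumes "x \<in> carrier E" "y \<in> carrier E" "u \<in> carrier E" "v \<in> carrier E" "x \<sqsubseteq> y" "u \<sqsubseteq> v"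
  shows "x \<oplus> u \<sqsubseteq> y \<oplus> v"
proof -
  have "x \<oplus> u \<sqsubseteq> y \<oplus> u"
    using assms by (simp add: add_right_mono)
  also have "y \<oplus> u \<sqsubseteq> y \<oplus> v"
    using assms by (simp add: add_right_mono add_comm[of y])
  finally show ?thesis
    using assms by simp
qed

lemma le_add_iff:
  assumes "x \<in> carrier E" "y \<in> carrier E" "z \<in> carrier E"
  shows "x \<sqsubseteq> y \<oplus> z \<longleftrightarrow> (- 1) \<odot> y \<oplus> x \<sqsubseteq> z"
proof
  assume "x \<sqsubseteq> y \<oplus> z"
  then have "(- 1) \<odot> y \<oplus> x \<sqsubseteq> (- 1) \<odot> y \<oplus> (y \<oplus> z)"
    using assms by (intro add_mono) auto
  then show "(- 1) \<odot> y \<oplus> x \<sqsubseteq> z"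
    using assms by simp
next
  assume "(- 1) \<odot> y \<oplus> x \<sqsubseteq> z"
  then have "y \<oplus> ((- 1) \<odot> y \<oplus> x) \<sqsubseteq> y \<oplus> z"
    using assms by (intro add_mono) auto
  then show "x \<sqsubseteq> y \<oplus> z"
    using assms by simp
qed

lemma neg_le_neg:
  assumes "x \<in> carrier E" "y \<in> carrier E" "x \<sqsubseteq> y"
  shows "(- 1) \<odot> y \<sqsubseteq> (- 1) \<odot> x"
proof -
  have "(- 1) \<odot> y \<sqsubseteq> (- 1) \<odot> x \<oplus> \<zero> \<longleftrightarrow> x \<oplus> (- 1) \<odot> y \<sqsubseteq> \<zero>"
    using assms by (subst le_add_iff) auto
  also have "\<dots> \<longleftrightarrow> x \<sqsubseteq> y \<oplus> \<zero>"
    using assms by (subst le_add_iff) (auto simp: add_comm)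
  finally show ?thesis
    using assms by simp
qed

lemma vabs_closed [simp]: "x \<in> carrier E \<Longrightarrow> vabs x \<in> carrier E"
  by (simp add: vabs_def)

lemma le_vabs: "x \<in> carrier E \<Longrightarrow> x \<sqsubseteq> vabs x"
  by (simp add: vabs_def join_left)

lemma neg_le_vabs: "x \<in> carrier E \<Longrightarrow> (- 1) \<odot> x \<sqsubseteq> vabs x"
  by (simp add: vabs_def join_right)

lemma vabs_le:
  "\<lbrakk>x \<in> carrier E; y \<in> carrier E; x \<sqsubseteq> y; (- 1) \<odot> x \<sqsubseteq> y\<rbrakk> \<Longrightarrow> vabs x \<sqsubseteq> y"
  by (simp add: vabs_def join_le)

text \<open>Adding \<open>x \<sqsubseteq> vabs x\<close> and
  \<open>(- 1) \<odot> x \<sqsubseteq> vabs x\<close> bounds twice the modulus below by zero;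
  scaling by one half finishes.\<close>

lemma vabs_nonneg:
  assumes "x \<in> carrier E" shows "\<zero> \<sqsubseteq> vabs x"
proof -
  have "x \<oplus> (- 1) \<odot> x \<sqsubseteq> vabs x \<oplus> vabs x"
    using assms by (intro add_mono le_vabs neg_le_vabs) auto
  then have "(1/2) \<odot> \<zero> \<sqsubseteq> (1/2) \<odot> (vabs x \<oplus> vabs x)"
    using assms by (intro scale_mono) auto
  also have "(1/2) \<odot> (vabs x \<oplus> vabs x) = vabs x"
    using assms by (simp add: scale_add_right flip: scale_add_left)
  finally show ?thesis
    using assms by simp
qed

lemma neg_nonpos:
  assumes "x \<in> carrier E" "\<zero> \<sqsubseteq> x" shows "(- 1) \<odot> x \<sqsubseteq> \<zero>"
  using neg_le_neg[OF _ assms] assms by simp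

lemma vabs_vabs_le:
  assumes "x \<in> carrier E" shows "vabs (vabs x) \<sqsubseteq> vabs x"
proof (rule vabs_le)
  show "(- 1) \<odot> vabs x \<sqsubseteq> vabs x"
    using neg_nonpos[OF _ vabs_nonneg] vabs_nonneg assms le_trans[of _ \<zero>] by simp
qed (use assms in simp_all)

lemma norm_vabs_le: "x \<in> carrier E \<Longrightarrow> vnorm E (vabs x) \<le> vnorm E x"
  by (simp add: norm_lattice vabs_vabs_le)

text \<open>The two bounds give \<open>vabs x \<sqsubseteq> y\<close>, and
  \<open>y \<sqsubseteq> vabs y\<close>, so the monotonicity of the norm in the modulus applies.
  This form avoids computing moduli of concrete elements.\<close>

lemma norm_le:
  assumes "x \<in> carrier E" "y \<in> carrier E" "x \<sqsubseteq> y" "(- 1) \<odot> x \<sqsubseteq> y"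
  shows "vnorm E x \<le> vnorm E y"
  using assms vabs_le[OF assms] by (meson norm_lattice le_trans le_vabs vabs_closed)

text \<open>Scaling by 0 gives the upper bound and the triangle inequality for
  \<open>\<zero> \<oplus> \<zero>\<close> the lower one.\<close>

lemma norm_zero [simp]: "vnorm E \<zero> = 0"
  using norm_scale_le[of \<zero> 0] norm_triangle[of \<zero> \<zero>] by simp

lemma norm_neg_le: "x \<in> carrier E \<Longrightarrow> vnorm E ((- 1) \<odot> x) \<le> vnorm E x"
  using norm_scale_le[of x "- 1"] by simp

lemma norm_nonneg: "x \<in> carrier E \<Longrightarrow> 0 \<le> vnorm E x"
  using norm_triangle[of x "(- 1) \<odot> x"] norm_neg_le[of x] by simp

text \<open>Join and meet both lie between \<open>(- 1) \<odot> b\<close> and \<open>b\<close>,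
  where \<open>b\<close> is the sum of the two moduli. The estimate serves to show that
  coordinatewise joins and meets of bounded families stay bounded.\<close>

lemma norm_join_meet_le:
  assumes "x \<in> carrier E" "y \<in> carrier E"
  shows "vnorm E (x \<squnion> y) \<le> vnorm E x + vnorm E y"
    and "vnorm E (x \<sqinter> y) \<le> vnorm E x + vnorm E y"
proof -
  define b where "b = vabs x \<oplus> vabs y"
  have b [simp]: "b \<in> carrier E"
    using assms by (simp add: b_def)
  have up: "vabs x \<sqsubseteq> b" "vabs y \<sqsubseteq> b"
    using add_mono[of "vabs x" "vabs x" \<zero> "vabs y"] add_mono[of \<zero> "vabs x" "vabs y" "vabs y"] assms vabs_nonneg
    by (simp_all add: b_def)
  have 1: "x \<sqsubseteq> b" "y \<sqsubseteq> b" and 2: "(- 1) \<odot> x \<sqsubseteq> b" "(- 1) \<odot> y \<sqsubseteq> b"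
    using assms up le_vabs neg_le_vabs by (meson b le_trans scale_closed vabs_closed)+
  have 3: "(- 1) \<odot> b \<sqsubseteq> x" "(- 1) \<odot> b \<sqsubseteq> y"
    using neg_le_neg[OF _ _ 2(1)] neg_le_neg[OF _ _ 2(2)] assms by simp_all
  have "vnorm E b \<le> vnorm E (vabs x) + vnorm E (vabs y)"
    using assms by (simp add: b_def norm_triangle)
  also have "\<dots> \<le> vnorm E x + vnorm E y"
    using assms by (intro add_mono_thms_linordered_semiring norm_vabs_le conjI)
  finally have nb: "vnorm E b \<le> vnorm E x + vnorm E y" .
  have "x \<squnion> y \<sqsubseteq> b" "(- 1) \<odot> b \<sqsubseteq> x \<sqinter> y"
    using assms 1 3 by (simp_all add: join_le meet_le)
  moreover have "x \<sqinter> y \<sqsubseteq> b"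
    using assms 1 meet_left[of x y] by (meson b le_trans meet_closed)
  moreover have "(- 1) \<odot> b \<sqsubseteq> x \<squnion> y"
    using assms 3 join_left[of x y] by (meson b le_trans join_closed scale_closed)
  ultimately have "vnorm E (x \<squnion> y) \<le> vnorm E b" "vnorm E (x \<sqinter> y) \<le> vnorm E b"
    using assms neg_le_neg[of "(- 1) \<odot> b" "x \<squnion> y"] neg_le_neg[of "(- 1) \<odot> b" "x \<sqinter> y"]
    by (auto intro!: norm_le)
  with nb show "vnorm E (x \<squnion> y) \<le> vnorm E x + vnorm E y" "vnorm E (x \<sqinter> y) \<le> vnorm E x + vnorm E y"
    by linarith+
qed

end


section \<open>Products and quotients\<close>

locale vlat_family =
  fixes Z :: "'i::countable \<Rightarrow> 'a normed_vlat"
  assumes seminormed_vlat: "\<And>i. seminormed_vlat (Z i)"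
begin

sublocale Z: seminormed_vlat "Z i" for i
  by (rule seminormed_vlat)

lemma linf_carrier_iff:
  "z \<in> carrier (linf Z) \<longleftrightarrow> (\<forall>i. z i \<in> carrier (Z i)) \<and> (\<exists>c. \<forall>i. vnorm (Z i) (z i) \<le> c)"
  by (auto simp: linf_def bdd_above_def)

lemma linf_carrierI:
  "\<lbrakk>\<And>i. z i \<in> carrier (Z i); \<And>i. vnorm (Z i) (z i) \<le> c\<rbrakk> \<Longrightarrow> z \<in> carrier (linf Z)"
  by (auto simp: linf_carrier_iff)

lemma linf_component: "z \<in> carrier (linf Z) \<Longrightarrow> z i \<in> carrier (Z i)"
  by (simp add: linf_carrier_iff)

lemma linf_norm_le_iff:
  "z \<in> carrier (linf Z) \<Longrightarrow> vnorm (linf Z) z \<le> c \<longleftrightarrow> (\<forall>i. vnorm (Z i) (z i) \<le> c)"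
  by (auto simp: linf_def cSUP_le_iff)

lemma linf_component_norm_le:
  "z \<in> carrier (linf Z) \<Longrightarrow> vnorm (Z i) (z i) \<le> vnorm (linf Z) z"
  using linf_norm_le_iff by blast

lemma linf_le: "x \<sqsubseteq>\<^bsub>linf Z\<^esub> y \<longleftrightarrow> (\<forall>i. x i \<sqsubseteq>\<^bsub>Z i\<^esub> y i)"
  and linf_add: "x \<oplus>\<^bsub>linf Z\<^esub> y = (\<lambda>i. x i \<oplus>\<^bsub>Z i\<^esub> y i)"
  and linf_zero: "\<zero>\<^bsub>linf Z\<^esub> = (\<lambda>i. \<zero>\<^bsub>Z i\<^esub>)"
  and linf_scale: "a \<odot>\<^bsub>linf Z\<^esub> x = (\<lambda>i. a \<odot>\<^bsub>Z i\<^esub> x i)"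
  by (simp_all add: linf_def)

lemmas linf_simps = linf_le linf_add linf_zero linf_scale

lemma linf_join_meet_closed:
  assumes "x \<in> carrier (linf Z)" "y \<in> carrier (linf Z)"
  shows "(\<lambda>i. x i \<squnion>\<^bsub>Z i\<^esub> y i) \<in> carrier (linf Z)" "(\<lambda>i. x i \<sqinter>\<^bsub>Z i\<^esub> y i) \<in> carrier (linf Z)"
proof -
  have "vnorm (Z i) (x i) + vnorm (Z i) (y i) \<le> vnorm (linf Z) x + vnorm (linf Z) y" for i
    using assms by (intro add_mono linf_component_norm_le)
  then show "(\<lambda>i. x i \<squnion>\<^bsub>Z i\<^esub> y i) \<in> carrier (linf Z)" "(\<lambda>i. x i \<sqinter>\<^bsub>Z i\<^esub> y i) \<in> carrier (linf Z)"
    using assms by (auto intro!: linf_carrierI Z.norm_join_meet_le[THEN order_trans] simp: linf_component)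
qed

lemma linf_add_closed:
  assumes x: "x \<in> carrier (linf Z)" and y: "y \<in> carrier (linf Z)"
  shows "x \<oplus>\<^bsub>linf Z\<^esub> y \<in> carrier (linf Z)"
    and "vnorm (linf Z) (x \<oplus>\<^bsub>linf Z\<^esub> y) \<le> vnorm (linf Z) x + vnorm (linf Z) y"
proof -
  have b: "vnorm (Z i) (x i \<oplus>\<^bsub>Z i\<^esub> y i) \<le> vnorm (linf Z) x + vnorm (linf Z) y" for i
    using assms linf_component_norm_le[OF x, of i] linf_component_norm_le[OF y, of i]
      Z.norm_triangle[of "x i" i "y i"] by (simp add: linf_component)
  then show c: "x \<oplus>\<^bsub>linf Z\<^esub> y \<in> carrier (linf Z)"
    using assms by (auto simp: linf_add linf_component intro!: linf_carrierI)
  show "vnorm (linf Z) (x \<oplus>\<^bsub>linf Z\<^esub> y) \<le> vnorm (linf Z) x + vnorm (linf Z) y"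
    using b linf_norm_le_iff[OF c] by (simp add: linf_add)
qed

lemma linf_scale_closed:
  assumes x: "x \<in> carrier (linf Z)"
  shows "a \<odot>\<^bsub>linf Z\<^esub> x \<in> carrier (linf Z)"
    and "vnorm (linf Z) (a \<odot>\<^bsub>linf Z\<^esub> x) \<le> \<bar>a\<bar> * vnorm (linf Z) x"
proof -
  have b: "vnorm (Z i) (a \<odot>\<^bsub>Z i\<^esub> x i) \<le> \<bar>a\<bar> * vnorm (linf Z) x" for i
    by (rule order_trans[OF Z.norm_scale_le])
      (use x in \<open>auto simp: linf_component linf_component_norm_le intro!: mult_left_mono\<close>)
  then show c: "a \<odot>\<^bsub>linf Z\<^esub> x \<in> carrier (linf Z)"
    using assms by (auto simp: linf_scale linf_component intro!: linf_carrierI)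
  show "vnorm (linf Z) (a \<odot>\<^bsub>linf Z\<^esub> x) \<le> \<bar>a\<bar> * vnorm (linf Z) x"
    using b linf_norm_le_iff[OF c] by (simp add: linf_scale)
qed

lemma lattice_linf: "lattice (linf Z)"
proof (rule latticeI)
  show "eq (linf Z) = (=)"
    by (simp add: linf_def)
next
  fix x y z
  assume "x \<in> carrier (linf Z)" "y \<in> carrier (linf Z)" "z \<in> carrier (linf Z)"
    "x \<sqsubseteq>\<^bsub>linf Z\<^esub> y" "y \<sqsubseteq>\<^bsub>linf Z\<^esub> z"
  then show "x \<sqsubseteq>\<^bsub>linf Z\<^esub> z"
    unfolding linf_le by (meson Z.le_trans linf_component)
next
  fix x y assume xy: "x \<in> carrier (linf Z)" "y \<in> carrier (linf Z)"
  show "\<exists>s\<in>carrier (linf Z). x \<sqsubseteq>\<^bsub>linf Z\<^esub> s \<and> y \<sqsubseteq>\<^bsub>linf Z\<^esub> s \<and>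
      (\<forall>u\<in>carrier (linf Z). x \<sqsubseteq>\<^bsub>linf Z\<^esub> u \<longrightarrow> y \<sqsubseteq>\<^bsub>linf Z\<^esub> u \<longrightarrow> s \<sqsubseteq>\<^bsub>linf Z\<^esub> u)"
    using xy by (intro bexI[OF _ linf_join_meet_closed(1)[OF xy]])
      (simp add: linf_le linf_component Z.join_left Z.join_right Z.join_le)
  show "\<exists>s\<in>carrier (linf Z). s \<sqsubseteq>\<^bsub>linf Z\<^esub> x \<and> s \<sqsubseteq>\<^bsub>linf Z\<^esub> y \<and>
      (\<forall>u\<in>carrier (linf Z). u \<sqsubseteq>\<^bsub>linf Z\<^esub> x \<longrightarrow> u \<sqsubseteq>\<^bsub>linf Z\<^esub> y \<longrightarrow> u \<sqsubseteq>\<^bsub>linf Z\<^esub> s)"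
    using xy by (intro bexI[OF _ linf_join_meet_closed(2)[OF xy]])
      (simp add: linf_le linf_component Z.meet_left Z.meet_right Z.meet_le)
next
  fix x y
  assume "x \<in> carrier (linf Z)" "y \<in> carrier (linf Z)" "x \<sqsubseteq>\<^bsub>linf Z\<^esub> y" "y \<sqsubseteq>\<^bsub>linf Z\<^esub> x"
  then show "x = y"
    by (intro ext) (meson Z.le_antisym linf_component linf_le)
qed (simp add: linf_le linf_component)

lemma linf_join:
  assumes "x \<in> carrier (linf Z)" "y \<in> carrier (linf Z)"
  shows "x \<squnion>\<^bsub>linf Z\<^esub> y = (\<lambda>i. x i \<squnion>\<^bsub>Z i\<^esub> y i)"
  using assms by (intro lattice.join_eqI[OF lattice_linf] linf_join_meet_closed)
    (simp_all add: linf_le linf_component Z.join_left Z.join_right Z.join_le)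

lemma linf_vabs:
  "x \<in> carrier (linf Z) \<Longrightarrow> vabs\<^bsub>linf Z\<^esub> x = (\<lambda>i. vabs\<^bsub>Z i\<^esub> (x i))"
  by (simp add: vabs_def linf_join linf_scale_closed) (simp add: linf_scale)

lemma seminormed_vlat_linf: "seminormed_vlat (linf Z)"
proof -
  interpret L: lattice "linf Z"
    by (rule lattice_linf)
  show ?thesis
  proof
    show "\<zero>\<^bsub>linf Z\<^esub> \<in> carrier (linf Z)"
      by (auto simp: linf_zero intro!: linf_carrierI)
  next
    fix x y assume xy: "x \<in> carrier (linf Z)" "y \<in> carrier (linf Z)"
      "vabs\<^bsub>linf Z\<^esub> x \<sqsubseteq>\<^bsub>linf Z\<^esub> vabs\<^bsub>linf Z\<^esub> y"
    then have "vnorm (Z i) (x i) \<le> vnorm (Z i) (y i)" for i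
      by (simp add: linf_vabs linf_le linf_component Z.norm_lattice)
    with xy linf_component_norm_le[of y] show "vnorm (linf Z) x \<le> vnorm (linf Z) y"
      by (simp add: linf_norm_le_iff) (meson order_trans)
  qed (auto simp: linf_add_closed linf_scale_closed, (auto simp: linf_simps linf_component
      Z.add_ac Z.scale_add_left Z.scale_add_right Z.add_right_mono Z.scale_mono))
qed

end

section \<open>Quotients by lattice ideals: order and lattice operations\<close>

text \<open>Solidity is phrased with the two bounds \<open>x \<sqsubseteq> y\<close> and
  \<open>(- 1) \<odot> x \<sqsubseteq> y\<close>. Together with closure under the modulus this
  yields the usual form: if \<open>vabs x \<sqsubseteq> vabs y\<close> and \<open>y\<close> is in
  \<open>J\<close>, then so is \<open>x\<close>.\<close>

locale vlat_ideal = seminormed_vlat +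
  fixes J :: "'a set"
  assumes ideal_subset: "J \<subseteq> carrier E"
    and ideal_zero [simp]: "\<zero> \<in> J"
    and ideal_add [simp]: "\<lbrakk>x \<in> J; y \<in> J\<rbrakk> \<Longrightarrow> x \<oplus> y \<in> J"
    and ideal_scale [simp]: "x \<in> J \<Longrightarrow> a \<odot> x \<in> J"
    and ideal_vabs: "x \<in> J \<Longrightarrow> vabs x \<in> J"
    and ideal_solid: "\<lbrakk>x \<in> carrier E; y \<in> J; x \<sqsubseteq> y; (- 1) \<odot> x \<sqsubseteq> y\<rbrakk> \<Longrightarrow> x \<in> J"
begin

lemma ideal_closed [simp]: "x \<in> J \<Longrightarrow> x \<in> carrier E"
  using ideal_subset by blast

lemma ideal_nonempty [simp]: "J \<noteq> {}"
  using ideal_zero by blast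

text \<open>The sum of the moduli dominates everything required. It is used to replace two error
  terms from \<open>J\<close> by a common one.\<close>

lemma ideal_directed:
  assumes "x \<in> J" "y \<in> J"
  obtains z where "z \<in> J" "\<zero> \<sqsubseteq> z" "x \<sqsubseteq> z" "y \<sqsubseteq> z"
proof
  show "vabs x \<oplus> vabs y \<in> J"
    using assms by (simp add: ideal_vabs)
  show "\<zero> \<sqsubseteq> vabs x \<oplus> vabs y" "x \<sqsubseteq> vabs x \<oplus> vabs y" "y \<sqsubseteq> vabs x \<oplus> vabs y"
    using assms add_mono[of \<zero> "vabs x" \<zero> "vabs y"] add_mono[of x "vabs x" \<zero> "vabs y"]
      add_mono[of \<zero> "vabs x" y "vabs y"]
    by (simp_all add: vabs_nonneg le_vabs)
qed

abbreviation "\<pi> \<equiv> coset E J"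

lemma mem_coset: "y \<in> \<pi> x \<longleftrightarrow> (\<exists>j\<in>J. y = x \<oplus> j)"
  by (auto simp: coset_def)

lemma self_mem_coset: "x \<in> carrier E \<Longrightarrow> x \<in> \<pi> x"
  unfolding mem_coset by (rule bexI[of _ \<zero>]) simp_all

lemma coset_add_ideal [simp]:
  assumes "x \<in> carrier E" "j \<in> J" shows "\<pi> (x \<oplus> j) = \<pi> x"
proof -
  have "x \<oplus> j \<oplus> k \<in> \<pi> x" if "k \<in> J" for k
    using assms that unfolding mem_coset by (intro bexI[of _ "j \<oplus> k"]) (simp_all add: add_assoc)
  moreover have "x \<oplus> k \<in> \<pi> (x \<oplus> j)" if "k \<in> J" for k
    using assms that unfolding mem_coset
    by (intro bexI[of _ "(- 1) \<odot> j \<oplus> k"]) (simp_all add: add_assoc)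
  ultimately show ?thesis
    using assms by (auto simp: mem_coset)
qed

lemma coset_eq_iff:
  assumes "x \<in> carrier E" "y \<in> carrier E"
  shows "\<pi> x = \<pi> y \<longleftrightarrow> x \<oplus> (- 1) \<odot> y \<in> J"
proof
  assume "\<pi> x = \<pi> y"
  then obtain j where "j \<in> J" "x = y \<oplus> j"
    using self_mem_coset assms(1) mem_coset by blast
  with assms show "x \<oplus> (- 1) \<odot> y \<in> J"
    by (simp add: add_comm[of "y \<oplus> j"])
next
  assume "x \<oplus> (- 1) \<odot> y \<in> J"
  then have "\<pi> (y \<oplus> (x \<oplus> (- 1) \<odot> y)) = \<pi> y"
    using assms by (intro coset_add_ideal)
  with assms show "\<pi> x = \<pi> y"
    by (simp add: add_comm[of x])
qed

lemma coset_add_cong: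
  assumes "x \<in> carrier E" "y \<in> carrier E" "j \<in> J" "k \<in> J"
  shows "\<pi> (x \<oplus> j \<oplus> (y \<oplus> k)) = \<pi> (x \<oplus> y)"
proof -
  have "x \<oplus> j \<oplus> (y \<oplus> k) = x \<oplus> y \<oplus> (j \<oplus> k)"
    using assms by (simp add: add_ac)
  with assms show ?thesis
    by simp
qed

lemma quot_carrier: "carrier (E //\<^sub>q J) = \<pi> ` carrier E"
  by (simp add: quot_def)

lemma quot_zero: "\<zero>\<^bsub>E //\<^sub>q J\<^esub> = \<pi> \<zero>"
  by (simp add: quot_def)

lemma quot_add:
  assumes "x \<in> carrier E" "y \<in> carrier E"
  shows "\<pi> x \<oplus>\<^bsub>E //\<^sub>q J\<^esub> \<pi> y = \<pi> (x \<oplus> y)"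
proof -
  have "(\<Union>a\<in>\<pi> x. \<Union>b\<in>\<pi> y. \<pi> (a \<oplus> b)) = (\<Union>a\<in>\<pi> x. \<Union>b\<in>\<pi> y. \<pi> (x \<oplus> y))"
    using assms by (intro SUP_cong refl) (auto simp: mem_coset coset_add_cong)
  also have "\<dots> = \<pi> (x \<oplus> y)"
    using assms self_mem_coset by blast
  finally show ?thesis
    by (simp add: quot_def)
qed

lemma quot_scale:
  assumes "x \<in> carrier E"
  shows "a \<odot>\<^bsub>E //\<^sub>q J\<^esub> \<pi> x = \<pi> (a \<odot> x)"
proof -
  have "(\<Union>b\<in>\<pi> x. \<pi> (a \<odot> b)) = (\<Union>b\<in>\<pi> x. \<pi> (a \<odot> x))"
    using assms by (intro SUP_cong refl) (auto simp: mem_coset scale_add_right)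
  also have "\<dots> = \<pi> (a \<odot> x)"
    using assms self_mem_coset by blast
  finally show ?thesis
    by (simp add: quot_def)
qed

lemma quot_le_unfold: "A \<sqsubseteq>\<^bsub>E //\<^sub>q J\<^esub> B \<longleftrightarrow> (\<exists>a\<in>A. \<exists>b\<in>B. a \<sqsubseteq> b)"
  by (simp add: quot_def)

text \<open>An inequality between classes only compares some pair of representatives. As
  \<open>J\<close> is a subspace, the errors of both representatives can be gathered on the right,
  so any fixed representatives are comparable up to a single error term.\<close>

lemma quot_le_iff:
  assumes "x \<in> carrier E" "y \<in> carrier E"
  shows "\<pi> x \<sqsubseteq>\<^bsub>E //\<^sub>q J\<^esub> \<pi> y \<longleftrightarrow> (\<exists>j\<in>J. x \<sqsubseteq> y \<oplus> j)"
proof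
  assume "\<pi> x \<sqsubseteq>\<^bsub>E //\<^sub>q J\<^esub> \<pi> y"
  then obtain a b where ab: "a \<in> \<pi> x" "b \<in> \<pi> y" "a \<sqsubseteq> b"
    unfolding quot_le_unfold by blast
  then obtain j k where "j \<in> J" "a = x \<oplus> j" "k \<in> J" "b = y \<oplus> k"
    unfolding mem_coset by blast
  with ab(3) have jk: "j \<in> J" "k \<in> J" "x \<oplus> j \<sqsubseteq> y \<oplus> k"
    by simp_all
  \<comment> \<open>Subtracting \<open>j\<close> on both sides frees \<open>x\<close> and leaves the
    error \<open>k \<oplus> (- 1) \<odot> j\<close>, which is in \<open>J\<close>.\<close>
  then have "x \<oplus> j \<oplus> (- 1) \<odot> j \<sqsubseteq> y \<oplus> k \<oplus> (- 1) \<odot> j"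
    using assms by (intro add_right_mono) auto
  with jk assms have "x \<sqsubseteq> y \<oplus> (k \<oplus> (- 1) \<odot> j)"
    by (simp add: add_assoc)
  with jk show "\<exists>j\<in>J. x \<sqsubseteq> y \<oplus> j"
    by (intro bexI[of _ "k \<oplus> (- 1) \<odot> j"]) auto
next
  assume "\<exists>j\<in>J. x \<sqsubseteq> y \<oplus> j"
  then obtain j where j: "j \<in> J" "x \<sqsubseteq> y \<oplus> j" ..
  then have "y \<oplus> j \<in> \<pi> y"
    unfolding mem_coset by blast
  with j(2) show "\<pi> x \<sqsubseteq>\<^bsub>E //\<^sub>q J\<^esub> \<pi> y"
    using self_mem_coset[OF assms(1)] unfolding quot_le_unfold by blast
qed

lemma quot_leI:
  "\<lbrakk>x \<in> carrier E; y \<in> carrier E; j \<in> J; x \<sqsubseteq> y \<oplus> j\<rbrakk> \<Longrightarrow> \<pi> x \<sqsubseteq>\<^bsub>E //\<^sub>q J\<^esub> \<pi> y"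
  using quot_le_iff by blast

lemma quot_leE:
  assumes "\<pi> x \<sqsubseteq>\<^bsub>E //\<^sub>q J\<^esub> \<pi> y" "x \<in> carrier E" "y \<in> carrier E"
  obtains j where "j \<in> J" "x \<sqsubseteq> y \<oplus> j"
  using assms quot_le_iff by blast

lemma quot_le: "\<lbrakk>x \<in> carrier E; y \<in> carrier E; x \<sqsubseteq> y\<rbrakk> \<Longrightarrow> \<pi> x \<sqsubseteq>\<^bsub>E //\<^sub>q J\<^esub> \<pi> y"
  by (rule quot_leI[of _ _ \<zero>]) simp_all

text \<open>With a common error \<open>l\<close> for both inequalities, \<open>u \<oplus> l\<close>
  is an upper bound of \<open>x\<close> and \<open>y\<close> in \<open>E\<close> itself, hence lies
  above their join. This makes the class map respect joins.\<close>

lemma coset_join_least: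
  assumes "x \<in> carrier E" "y \<in> carrier E" "u \<in> carrier E"
    and "\<pi> x \<sqsubseteq>\<^bsub>E //\<^sub>q J\<^esub> \<pi> u" "\<pi> y \<sqsubseteq>\<^bsub>E //\<^sub>q J\<^esub> \<pi> u"
  shows "\<pi> (x \<squnion> y) \<sqsubseteq>\<^bsub>E //\<^sub>q J\<^esub> \<pi> u"
proof -
  obtain j k where jk: "j \<in> J" "k \<in> J" "x \<sqsubseteq> u \<oplus> j" "y \<sqsubseteq> u \<oplus> k"
    using assms by (elim quot_leE)
  obtain l where l: "l \<in> J" "j \<sqsubseteq> l" "k \<sqsubseteq> l"
    by (rule ideal_directed[OF jk(1,2)])
  have "u \<oplus> j \<sqsubseteq> u \<oplus> l" "u \<oplus> k \<sqsubseteq> u \<oplus> l"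
    using assms jk l by (simp_all add: add_mono)
  then have "x \<sqsubseteq> u \<oplus> l" "y \<sqsubseteq> u \<oplus> l"
    using assms jk l le_trans[of x "u \<oplus> j" "u \<oplus> l"] le_trans[of y "u \<oplus> k" "u \<oplus> l"]
    by simp_all
  then have "x \<squnion> y \<sqsubseteq> u \<oplus> l"
    using assms l by (simp add: join_le)
  with assms l show ?thesis
    by (intro quot_leI) simp_all
qed

lemma coset_meet_greatest:
  assumes "x \<in> carrier E" "y \<in> carrier E" "u \<in> carrier E"
    and "\<pi> u \<sqsubseteq>\<^bsub>E //\<^sub>q J\<^esub> \<pi> x" "\<pi> u \<sqsubseteq>\<^bsub>E //\<^sub>q J\<^esub> \<pi> y"
  shows "\<pi> u \<sqsubseteq>\<^bsub>E //\<^sub>q J\<^esub> \<pi> (x \<sqinter> y)"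
proof -
  obtain j k where jk: "j \<in> J" "k \<in> J" "u \<sqsubseteq> x \<oplus> j" "u \<sqsubseteq> y \<oplus> k"
    using assms by (elim quot_leE)
  obtain l where l: "l \<in> J" "j \<sqsubseteq> l" "k \<sqsubseteq> l"
    by (rule ideal_directed[OF jk(1,2)])
  have "x \<oplus> j \<sqsubseteq> x \<oplus> l" "y \<oplus> k \<sqsubseteq> y \<oplus> l"
    using assms jk l by (simp_all add: add_mono)
  then have "u \<sqsubseteq> x \<oplus> l" "u \<sqsubseteq> y \<oplus> l"
    using assms jk l le_trans[of u "x \<oplus> j" "x \<oplus> l"] le_trans[of u "y \<oplus> k" "y \<oplus> l"]
    by simp_all
  \<comment> \<open>With \<open>l\<close> in front, \<open>le_add_iff\<close> moves it to the left;
    the shifted element \<open>(- 1) \<odot> l \<oplus> u\<close> is then a lower bound of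
    \<open>x\<close> and \<open>y\<close> in \<open>E\<close>.\<close>
  then have "u \<sqsubseteq> l \<oplus> x" "u \<sqsubseteq> l \<oplus> y"
    using assms l by (simp_all add: add_comm)
  then have "(- 1) \<odot> l \<oplus> u \<sqsubseteq> x \<sqinter> y"
    using assms l by (simp add: le_add_iff meet_le)
  then have "u \<sqsubseteq> (x \<sqinter> y) \<oplus> l"
    using assms l le_add_iff[of u l "x \<sqinter> y"] by (simp add: add_comm)
  with assms l show ?thesis
    by (intro quot_leI) simp_all
qed

lemma lattice_quot: "lattice (E //\<^sub>q J)"
proof (rule latticeI)
  show "eq (E //\<^sub>q J) = (=)"
    by (simp add: quot_def)
next
  fix A assume "A \<in> carrier (E //\<^sub>q J)"
  then show "A \<sqsubseteq>\<^bsub>E //\<^sub>q J\<^esub> A"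
    by (auto simp: quot_carrier quot_le)
next
  fix A B assume "A \<in> carrier (E //\<^sub>q J)" "B \<in> carrier (E //\<^sub>q J)"
    and le: "A \<sqsubseteq>\<^bsub>E //\<^sub>q J\<^esub> B" "B \<sqsubseteq>\<^bsub>E //\<^sub>q J\<^esub> A"
  then obtain x y where xy: "x \<in> carrier E" "y \<in> carrier E" "A = \<pi> x" "B = \<pi> y"
    by (auto simp: quot_carrier)
  obtain j k where jk: "j \<in> J" "k \<in> J" "x \<sqsubseteq> y \<oplus> j" "y \<sqsubseteq> x \<oplus> k"
    using le xy(1,2) unfolding xy by (elim quot_leE)
  obtain l where l: "l \<in> J" "j \<sqsubseteq> l" "k \<sqsubseteq> l"
    by (rule ideal_directed[OF jk(1,2)])
  \<comment> \<open>Antisymmetry comes from solidity: \<open>d\<close> and its negative are both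
    below \<open>l\<close>, so the difference of the representatives is in \<open>J\<close>. The
    order of the summands matches \<open>le_add_iff\<close>.\<close>
  define d where "d = (- 1) \<odot> y \<oplus> x"
  have d: "d \<in> carrier E" "(- 1) \<odot> d = (- 1) \<odot> x \<oplus> y"
    using xy by (simp_all add: d_def scale_add_right add_comm)
  have "d \<sqsubseteq> j" "(- 1) \<odot> d \<sqsubseteq> k"
    using jk xy unfolding d(2) by (simp_all add: d_def le_add_iff)
  then have "d \<sqsubseteq> l" "(- 1) \<odot> d \<sqsubseteq> l"
    using d(1) jk l by (meson ideal_closed le_trans scale_closed)+
  then have "d \<in> J"
    using d(1) l(1) ideal_solid by blast
  with xy show "A = B"
    by (simp add: coset_eq_iff d_def add_comm)
next
  fix A B C
  assume "A \<in> carrier (E //\<^sub>q J)" "B \<in> carrier (E //\<^sub>q J)" "C \<in> carrier (E //\<^sub>q J)"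
    and le: "A \<sqsubseteq>\<^bsub>E //\<^sub>q J\<^esub> B" "B \<sqsubseteq>\<^bsub>E //\<^sub>q J\<^esub> C"
  then obtain x y z where xyz: "x \<in> carrier E" "y \<in> carrier E" "z \<in> carrier E"
      "A = \<pi> x" "B = \<pi> y" "C = \<pi> z"
    by (auto simp: quot_carrier)
  obtain j k where jk: "j \<in> J" "k \<in> J" "x \<sqsubseteq> y \<oplus> j" "y \<sqsubseteq> z \<oplus> k"
    using le xyz(1-3) unfolding xyz by (elim quot_leE)
  have "y \<oplus> j \<sqsubseteq> z \<oplus> k \<oplus> j"
    using jk xyz by (simp add: add_right_mono)
  then have "x \<sqsubseteq> z \<oplus> (k \<oplus> j)"
    using jk xyz le_trans[of x "y \<oplus> j" "z \<oplus> k \<oplus> j"] by (simp add: add_assoc)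
  with jk xyz show "A \<sqsubseteq>\<^bsub>E //\<^sub>q J\<^esub> C"
    by (simp add: quot_leI[of _ _ "k \<oplus> j"])
next
  fix A B assume "A \<in> carrier (E //\<^sub>q J)" "B \<in> carrier (E //\<^sub>q J)"
  then obtain x y where xy: "x \<in> carrier E" "y \<in> carrier E" "A = \<pi> x" "B = \<pi> y"
    by (auto simp: quot_carrier)
  show "\<exists>S\<in>carrier (E //\<^sub>q J). A \<sqsubseteq>\<^bsub>E //\<^sub>q J\<^esub> S \<and> B \<sqsubseteq>\<^bsub>E //\<^sub>q J\<^esub> S \<and>
      (\<forall>U\<in>carrier (E //\<^sub>q J). A \<sqsubseteq>\<^bsub>E //\<^sub>q J\<^esub> U \<longrightarrow> B \<sqsubseteq>\<^bsub>E //\<^sub>q J\<^esub> U \<longrightarrow> S \<sqsubseteq>\<^bsub>E //\<^sub>q J\<^esub> U)"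
    using xy by (intro bexI[of _ "\<pi> (x \<squnion> y)"])
      (auto simp: quot_carrier quot_le join_left join_right coset_join_least)
  show "\<exists>S\<in>carrier (E //\<^sub>q J). S \<sqsubseteq>\<^bsub>E //\<^sub>q J\<^esub> A \<and> S \<sqsubseteq>\<^bsub>E //\<^sub>q J\<^esub> B \<and>
      (\<forall>U\<in>carrier (E //\<^sub>q J). U \<sqsubseteq>\<^bsub>E //\<^sub>q J\<^esub> A \<longrightarrow> U \<sqsubseteq>\<^bsub>E //\<^sub>q J\<^esub> B \<longrightarrow> U \<sqsubseteq>\<^bsub>E //\<^sub>q J\<^esub> S)"
    using xy by (intro bexI[of _ "\<pi> (x \<sqinter> y)"])
      (auto simp: quot_carrier quot_le meet_left meet_right coset_meet_greatest)
qed

lemma quot_join: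
  assumes "x \<in> carrier E" "y \<in> carrier E"
  shows "\<pi> x \<squnion>\<^bsub>E //\<^sub>q J\<^esub> \<pi> y = \<pi> (x \<squnion> y)"
  using assms by (intro lattice.join_eqI[OF lattice_quot])
    (auto simp: quot_carrier quot_le join_left join_right coset_join_least)

lemma quot_vabs: "x \<in> carrier E \<Longrightarrow> vabs\<^bsub>E //\<^sub>q J\<^esub> (\<pi> x) = \<pi> (vabs x)"
  by (simp add: vabs_def quot_scale quot_join)

section \<open>The quotient norm\<close>

lemma quot_norm: "vnorm (E //\<^sub>q J) (\<pi> x) = (INF j\<in>J. vnorm E (x \<oplus> j))"
  by (simp add: quot_def coset_def image_image)

lemma quot_norm_le:
  assumes "x \<in> carrier E" "j \<in> J"
  shows "vnorm (E //\<^sub>q J) (\<pi> x) \<le> vnorm E (x \<oplus> j)"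
  unfolding quot_norm using assms
  by (intro cINF_lower) (auto intro!: bdd_belowI2[of _ 0] norm_nonneg)

lemma quot_norm_less:
  assumes "x \<in> carrier E" "vnorm (E //\<^sub>q J) (\<pi> x) < c"
  obtains j where "j \<in> J" "vnorm E (x \<oplus> j) < c"
  using assms(2) unfolding quot_norm
  by (subst (asm) cINF_less_iff) (use assms(1) in \<open>auto intro!: bdd_belowI2[of _ 0] norm_nonneg\<close>)

text \<open>The hypothesis compares classes only, so an arbitrary representative of the class of
  \<open>x\<close> may be far too large. The remedy is to pick a representative of the class of
  \<open>y\<close> with nearly minimal norm and to truncate \<open>x\<close> at its modulus: the
  class is unchanged, while the norm is now controlled by that of the chosen representative.\<close>

lemma quot_norm_mono:
  assumes x: "x \<in> carrier E" and y: "y \<in> carrier E"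
    and le: "vabs\<^bsub>E //\<^sub>q J\<^esub> (\<pi> x) \<sqsubseteq>\<^bsub>E //\<^sub>q J\<^esub> vabs\<^bsub>E //\<^sub>q J\<^esub> (\<pi> y)"
  shows "vnorm (E //\<^sub>q J) (\<pi> x) \<le> vnorm (E //\<^sub>q J) (\<pi> y)"
proof (rule dense_ge)
  interpret Q: lattice "E //\<^sub>q J"
    by (rule lattice_quot)
  fix c assume "vnorm (E //\<^sub>q J) (\<pi> y) < c"
  then obtain j where j: "j \<in> J" "vnorm E (y \<oplus> j) < c"
    using quot_norm_less y by blast
  define u where "u = vabs (y \<oplus> j)"
  have u: "u \<in> carrier E" "\<zero> \<sqsubseteq> u"
    using y j by (simp_all add: u_def vabs_nonneg)
  have nu: "(- 1) \<odot> u \<sqsubseteq> u"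
    using u neg_nonpos le_trans[of _ \<zero>] by simp
  text \<open>Truncating \<open>x\<close> at \<open>\<plusminus> u\<close> changes it only by an element of \<open>J\<close>.\<close>
  define x' where "x' = (x \<sqinter> u) \<squnion> ((- 1) \<odot> u)"
  have x': "x' \<in> carrier E" "x' \<sqsubseteq> u" "(- 1) \<odot> u \<sqsubseteq> x'"
    using x u nu by (simp_all add: x'_def join_le meet_right join_right)
  have pu: "\<pi> u = vabs\<^bsub>E //\<^sub>q J\<^esub> (\<pi> y)"
    using quot_vabs[of "y \<oplus> j"] y j by (simp add: u_def)
  have "\<pi> x \<sqsubseteq>\<^bsub>E //\<^sub>q J\<^esub> vabs\<^bsub>E //\<^sub>q J\<^esub> (\<pi> x)" "\<pi> ((- 1) \<odot> x) \<sqsubseteq>\<^bsub>E //\<^sub>q J\<^esub> vabs\<^bsub>E //\<^sub>q J\<^esub> (\<pi> x)"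
    using x by (simp_all add: quot_vabs quot_le le_vabs neg_le_vabs)
  then have xu: "\<pi> x \<sqsubseteq>\<^bsub>E //\<^sub>q J\<^esub> \<pi> u" "\<pi> ((- 1) \<odot> x) \<sqsubseteq>\<^bsub>E //\<^sub>q J\<^esub> \<pi> u"
    using le x y u Q.le_trans[of _ "vabs\<^bsub>E //\<^sub>q J\<^esub> (\<pi> x)" "\<pi> u"] unfolding pu
    by (simp_all add: quot_vabs quot_carrier)
  \<comment> \<open>The inequality for \<open>(- 1) \<odot> x\<close> is turned into a lower bound
    for the class of \<open>x\<close>; negation puts the error term \<open>k\<close> on the side of
    \<open>x\<close>.\<close>
  obtain k where k: "k \<in> J" "(- 1) \<odot> x \<sqsubseteq> u \<oplus> k"
    using xu(2) x u by (elim quot_leE) simp_all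
  have "(- 1) \<odot> (u \<oplus> k) \<sqsubseteq> x"
    using neg_le_neg[OF _ _ k(2)] k x u by simp
  then have "(- 1) \<odot> u \<sqsubseteq> x \<oplus> k"
    using k x u by (simp add: scale_add_right add_comm[of x] le_add_iff add_comm)
  then have ux: "\<pi> ((- 1) \<odot> u) \<sqsubseteq>\<^bsub>E //\<^sub>q J\<^esub> \<pi> x"
    using k x u by (simp add: quot_leI)
  \<comment> \<open>In the quotient, the meet with \<open>u\<close> does not lower the class, which
    is already below that of \<open>u\<close>, and the join with \<open>(- 1) \<odot> u\<close> does
    not raise it, since it is already above that of \<open>(- 1) \<odot> u\<close>.\<close>
  have "\<pi> x' = \<pi> x"
  proof (rule Q.le_antisym)
    have "\<pi> (x \<sqinter> u) \<sqsubseteq>\<^bsub>E //\<^sub>q J\<^esub> \<pi> x"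
      using x u by (simp add: quot_le meet_left)
    then show "\<pi> x' \<sqsubseteq>\<^bsub>E //\<^sub>q J\<^esub> \<pi> x"
      using x u ux by (simp add: x'_def coset_join_least)
    have "\<pi> x \<sqsubseteq>\<^bsub>E //\<^sub>q J\<^esub> \<pi> (x \<sqinter> u)"
      using x u xu by (simp add: coset_meet_greatest quot_le)
    also have "\<pi> (x \<sqinter> u) \<sqsubseteq>\<^bsub>E //\<^sub>q J\<^esub> \<pi> x'"
      using x u by (simp add: x'_def quot_le join_left)
    finally show "\<pi> x \<sqsubseteq>\<^bsub>E //\<^sub>q J\<^esub> \<pi> x'"
      using x u x' by (simp add: quot_carrier)
  qed (use x x' in \<open>auto simp: quot_carrier\<close>)
  then have "vnorm (E //\<^sub>q J) (\<pi> x) \<le> vnorm E x'"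
    using quot_norm_le[OF x'(1) ideal_zero] x' by simp
  also have "vnorm E x' \<le> vnorm E u"
    using x' u neg_le_neg[OF _ _ x'(3)] by (intro norm_le) auto
  also have "\<dots> \<le> vnorm E (y \<oplus> j)"
    using y j by (simp add: u_def norm_vabs_le)
  finally show "vnorm (E //\<^sub>q J) (\<pi> x) \<le> c"
    using j by simp
qed

lemma quot_norm_scale_le:
  assumes x: "x \<in> carrier E"
  shows "vnorm (E //\<^sub>q J) (\<pi> (a \<odot> x)) \<le> \<bar>a\<bar> * vnorm (E //\<^sub>q J) (\<pi> x)"
proof -
  have *: "vnorm (E //\<^sub>q J) (\<pi> (a \<odot> x)) \<le> \<bar>a\<bar> * vnorm E (x \<oplus> j)" if j: "j \<in> J" for j
  proof -
    have "vnorm (E //\<^sub>q J) (\<pi> (a \<odot> x)) \<le> vnorm E (a \<odot> (x \<oplus> j))"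
      using quot_norm_le[of "a \<odot> x" "a \<odot> j"] x j by (simp add: scale_add_right)
    also have "\<dots> \<le> \<bar>a\<bar> * vnorm E (x \<oplus> j)"
      using x j by (simp add: norm_scale_le)
    finally show ?thesis .
  qed
  show ?thesis
  \<comment> \<open>For nonzero \<open>a\<close> the bound is divided by its absolute value to pass
    to the infimum over \<open>j\<close>; for \<open>a = 0\<close> the single choice
    \<open>j = \<zero>\<close> already gives the bound 0.\<close>
  proof (cases "a = 0")
    case True
    then show ?thesis
      using *[of \<zero>] by simp
  next
    case False
    have "vnorm (E //\<^sub>q J) (\<pi> (a \<odot> x)) / \<bar>a\<bar> \<le> vnorm (E //\<^sub>q J) (\<pi> x)"
      unfolding quot_norm[of x] using False *
      by (intro cINF_greatest) (auto simp: field_simps)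
    with False show ?thesis
      by (simp add: field_simps)
  qed
qed

lemma quot_norm_triangle:
  assumes x: "x \<in> carrier E" and y: "y \<in> carrier E"
  shows "vnorm (E //\<^sub>q J) (\<pi> (x \<oplus> y)) \<le> vnorm (E //\<^sub>q J) (\<pi> x) + vnorm (E //\<^sub>q J) (\<pi> y)"
proof (rule field_le_epsilon)
  fix e :: real assume "e > 0"
  then obtain j k where jk: "j \<in> J" "k \<in> J"
    and "vnorm E (x \<oplus> j) < vnorm (E //\<^sub>q J) (\<pi> x) + e / 2"
    and "vnorm E (y \<oplus> k) < vnorm (E //\<^sub>q J) (\<pi> y) + e / 2"
    using quot_norm_less[OF x, of "vnorm (E //\<^sub>q J) (\<pi> x) + e / 2"]
      quot_norm_less[OF y, of "vnorm (E //\<^sub>q J) (\<pi> y) + e / 2"] by (metis half_gt_zero less_add_same_cancel1)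
  \<comment> \<open>The sum of two nearly optimal representatives represents the sum of the
    classes.\<close>
  moreover have "vnorm (E //\<^sub>q J) (\<pi> (x \<oplus> y)) \<le> vnorm E (x \<oplus> j \<oplus> (y \<oplus> k))"
    using quot_norm_le[of "x \<oplus> j \<oplus> (y \<oplus> k)" \<zero>] x y jk by (simp add: coset_add_cong)
  moreover have "vnorm E (x \<oplus> j \<oplus> (y \<oplus> k)) \<le> vnorm E (x \<oplus> j) + vnorm E (y \<oplus> k)"
    using x y jk by (simp add: norm_triangle)
  ultimately show "vnorm (E //\<^sub>q J) (\<pi> (x \<oplus> y))
      \<le> vnorm (E //\<^sub>q J) (\<pi> x) + vnorm (E //\<^sub>q J) (\<pi> y) + e"
    by linarith
qed

lemma seminormed_vlat_quot: "seminormed_vlat (E //\<^sub>q J)"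
proof -
  interpret Q: lattice "E //\<^sub>q J"
    by (rule lattice_quot)
  show ?thesis
  proof
    fix A B C assume "A \<in> carrier (E //\<^sub>q J)" "B \<in> carrier (E //\<^sub>q J)" "C \<in> carrier (E //\<^sub>q J)"
      and le: "A \<sqsubseteq>\<^bsub>E //\<^sub>q J\<^esub> B"
    then obtain x y z where xyz: "x \<in> carrier E" "y \<in> carrier E" "z \<in> carrier E"
        "A = \<pi> x" "B = \<pi> y" "C = \<pi> z"
      by (auto simp: quot_carrier)
    then obtain j where j: "j \<in> J" "x \<sqsubseteq> y \<oplus> j"
      using le quot_leE by blast
    then have "x \<oplus> z \<sqsubseteq> y \<oplus> z \<oplus> j"
      using add_right_mono[OF _ _ _ j(2), of z] xyz by (simp add: add_assoc add_comm[of j])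
    with xyz j show "A \<oplus>\<^bsub>E //\<^sub>q J\<^esub> C \<sqsubseteq>\<^bsub>E //\<^sub>q J\<^esub> B \<oplus>\<^bsub>E //\<^sub>q J\<^esub> C"
      by (simp add: quot_add quot_leI)
  next
    fix A B and a :: real assume "A \<in> carrier (E //\<^sub>q J)" "B \<in> carrier (E //\<^sub>q J)" and a: "0 \<le> a"
      and le: "A \<sqsubseteq>\<^bsub>E //\<^sub>q J\<^esub> B"
    then obtain x y where xy: "x \<in> carrier E" "y \<in> carrier E" "A = \<pi> x" "B = \<pi> y"
      by (auto simp: quot_carrier)
    then obtain j where j: "j \<in> J" "x \<sqsubseteq> y \<oplus> j"
      using le quot_leE by blast
    then have "a \<odot> x \<sqsubseteq> a \<odot> y \<oplus> a \<odot> j"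
      using scale_mono[OF _ _ a j(2)] xy by (simp add: scale_add_right)
    with xy j show "a \<odot>\<^bsub>E //\<^sub>q J\<^esub> A \<sqsubseteq>\<^bsub>E //\<^sub>q J\<^esub> a \<odot>\<^bsub>E //\<^sub>q J\<^esub> B"
      by (simp add: quot_scale quot_leI[of _ _ "a \<odot> j"])
  next
    fix A B assume "A \<in> carrier (E //\<^sub>q J)" "B \<in> carrier (E //\<^sub>q J)"
      and "vabs\<^bsub>E //\<^sub>q J\<^esub> A \<sqsubseteq>\<^bsub>E //\<^sub>q J\<^esub> vabs\<^bsub>E //\<^sub>q J\<^esub> B"
    then show "vnorm (E //\<^sub>q J) A \<le> vnorm (E //\<^sub>q J) B"
      by (auto simp: quot_carrier quot_norm_mono)
  qed (auto simp: quot_carrier quot_add quot_scale quot_zero quot_norm_scale_le quot_norm_triangle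
      add_ac scale_add_left scale_add_right)
qed

end


text \<open>The infimum defining the quotient norm need not be attained, so some slack is required.
  A slack of 1 that is the same for all classes suffices to lift bounded sequences of classes to
  bounded sequences.\<close>

lemma (in vlat_ideal) quot_representative:
  assumes "A \<in> carrier (E //\<^sub>q J)"
  obtains x where "x \<in> carrier E" "A = \<pi> x" "vnorm E x \<le> vnorm (E //\<^sub>q J) A + 1"
proof -
  obtain y where y: "y \<in> carrier E" "A = \<pi> y"
    using assms by (auto simp: quot_carrier)
  obtain j where j: "j \<in> J" "vnorm E (y \<oplus> j) < vnorm (E //\<^sub>q J) (\<pi> y) + 1"
    using quot_norm_less[OF y(1), of "vnorm (E //\<^sub>q J) (\<pi> y) + 1"] by auto
  with y show thesis
    by (intro that[of "y \<oplus> j"]) simp_all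
qed

text \<open>This is the first isomorphism theorem: \<open>\<Phi>\<close> factors through the class
  map, and \<open>ker\<close> makes the induced map both well defined and injective. Preservation of
  meets follows from bijectivity and preservation of joins.\<close>

lemma lattice_isometric_quotI:
  fixes H :: "'b normed_vlat"
  assumes J: "vlat_ideal E J" and H: "lattice H"
    and surj: "\<Phi> ` carrier E = carrier H"
    and ker: "\<And>x y. \<lbrakk>x \<in> carrier E; y \<in> carrier E\<rbrakk> \<Longrightarrow> \<Phi> x = \<Phi> y \<longleftrightarrow> coset E J x = coset E J y"
    and add: "\<And>x y. \<lbrakk>x \<in> carrier E; y \<in> carrier E\<rbrakk> \<Longrightarrow> \<Phi> (x \<oplus>\<^bsub>E\<^esub> y) = \<Phi> x \<oplus>\<^bsub>H\<^esub> \<Phi> y"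
    and scale: "\<And>a x. x \<in> carrier E \<Longrightarrow> \<Phi> (a \<odot>\<^bsub>E\<^esub> x) = a \<odot>\<^bsub>H\<^esub> \<Phi> x"
    and join: "\<And>x y. \<lbrakk>x \<in> carrier E; y \<in> carrier E\<rbrakk> \<Longrightarrow> \<Phi> (x \<squnion>\<^bsub>E\<^esub> y) = \<Phi> x \<squnion>\<^bsub>H\<^esub> \<Phi> y"
    and norm: "\<And>x. x \<in> carrier E \<Longrightarrow> vnorm H (\<Phi> x) = vnorm (E //\<^sub>q J) (coset E J x)"
  shows "E //\<^sub>q J \<equiv>\<^sub>\<le> H"
proof -
  interpret vlat_ideal E J by fact
  \<comment> \<open>The choice of representative is harmless: by \<open>ker\<close>,
    \<open>\<Phi>\<close> takes the same value on all representatives in the carrier.\<close>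
  define T where "T A = \<Phi> (SOME x. x \<in> carrier E \<and> \<pi> x = A)" for A
  have T: "T (\<pi> x) = \<Phi> x" if x: "x \<in> carrier E" for x
  proof -
    have "\<exists>y. y \<in> carrier E \<and> \<pi> y = \<pi> x"
      using x by blast
    from someI_ex[OF this] show ?thesis
      unfolding T_def using x ker by blast
  qed
  have inj: "inj_on T (carrier (E //\<^sub>q J))"
    unfolding inj_on_def quot_carrier by (simp add: T ker)
  have "T ` carrier (E //\<^sub>q J) = carrier H"
    unfolding quot_carrier image_image by (simp add: T surj)
  with inj have bij: "bij_betw T (carrier (E //\<^sub>q J)) (carrier H)"
    by (simp add: bij_betw_def)
  have T_join: "T (A \<squnion>\<^bsub>E //\<^sub>q J\<^esub> B) = T A \<squnion>\<^bsub>H\<^esub> T B"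
    if "A \<in> carrier (E //\<^sub>q J)" "B \<in> carrier (E //\<^sub>q J)" for A B
    using that by (auto simp: quot_carrier quot_join T join)
  have "join_pres (E //\<^sub>q J) H T"
    using T_join H lattice_quot by (simp add: join_pres_def)
  moreover have "meet_pres (E //\<^sub>q J) H T"
    using join_iso_meet_pres[OF lattice_quot H bij T_join] .
  ultimately show ?thesis
    unfolding lattice_isometric_def using bij
    by (intro exI[of _ T]) (simp add: quot_carrier quot_add quot_scale T add scale norm)
qed

section \<open>The ideals \<open>c\<^sub>0\<^sub>,\<^sub>I\<close>\<close>

context vlat_family
begin

lemma c0_iff:
  "z \<in> c0 I Z \<longleftrightarrow> z \<in> carrier (linf Z) \<and> (\<forall>\<epsilon>>0. {i. \<epsilon> \<le> vnorm (Z i) (z i)} \<in> I)"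
  by (simp add: c0_def)

lemma c0_dominated:
  assumes I: "set_ideal I" and z: "z \<in> carrier (linf Z)" and y: "y \<in> c0 I Z"
    and le: "\<And>i. vnorm (Z i) (z i) \<le> vnorm (Z i) (y i)"
  shows "z \<in> c0 I Z"
  unfolding c0_iff
proof (intro conjI allI impI)
  fix \<epsilon> :: real assume "\<epsilon> > 0"
  then have "{i. \<epsilon> \<le> vnorm (Z i) (y i)} \<in> I"
    using y by (simp add: c0_iff)
  moreover have "{i. \<epsilon> \<le> vnorm (Z i) (z i)} \<subseteq> {i. \<epsilon> \<le> vnorm (Z i) (y i)}"
    using le order_trans by blast
  ultimately show "{i. \<epsilon> \<le> vnorm (Z i) (z i)} \<in> I"
    using I unfolding set_ideal_def by blast
qed (rule z)

lemma vlat_ideal_c0: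
  assumes I: "set_ideal I"
  shows "vlat_ideal (linf Z) (c0 I Z)"
proof -
  interpret L: seminormed_vlat "linf Z"
    by (rule seminormed_vlat_linf)
  have sub: "A \<in> I" if "A \<subseteq> B" "B \<in> I" for A B
    using I that unfolding set_ideal_def by blast
  have un: "A \<union> B \<in> I" if "A \<in> I" "B \<in> I" for A B
    using I that unfolding set_ideal_def by blast
  show ?thesis
  proof
    show "c0 I Z \<subseteq> carrier (linf Z)"
      by (auto simp: c0_iff)
    show "\<zero>\<^bsub>linf Z\<^esub> \<in> c0 I Z"
      unfolding c0_iff using I L.zero_closed by (simp add: linf_zero set_ideal_def)
  next
    fix x y assume "x \<in> c0 I Z" "y \<in> c0 I Z"
    then have x: "x \<in> carrier (linf Z)" "\<And>\<epsilon>. \<epsilon> > 0 \<Longrightarrow> {i. \<epsilon> \<le> vnorm (Z i) (x i)} \<in> I"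
      and y: "y \<in> carrier (linf Z)" "\<And>\<epsilon>. \<epsilon> > 0 \<Longrightarrow> {i. \<epsilon> \<le> vnorm (Z i) (y i)} \<in> I"
      by (simp_all add: c0_iff)
    have "{i. \<epsilon> \<le> vnorm (Z i) (x i \<oplus>\<^bsub>Z i\<^esub> y i)} \<in> I" if "\<epsilon> > 0" for \<epsilon>
    proof (rule sub)
      \<comment> \<open>Where both summands have norm below \<open>\<epsilon> / 2\<close>, the sum
        has norm below \<open>\<epsilon>\<close>; the exceptional coordinates thus lie in this
        union.\<close>
      show "{i. \<epsilon> / 2 \<le> vnorm (Z i) (x i)} \<union> {i. \<epsilon> / 2 \<le> vnorm (Z i) (y i)} \<in> I"
        using that by (intro un x y) simp_all
      have "\<epsilon> / 2 \<le> vnorm (Z i) (x i) \<or> \<epsilon> / 2 \<le> vnorm (Z i) (y i)"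
        if "\<epsilon> \<le> vnorm (Z i) (x i \<oplus>\<^bsub>Z i\<^esub> y i)" for i
        using that Z.norm_triangle[OF linf_component[OF x(1)] linf_component[OF y(1)], of i]
        by linarith
      then show "{i. \<epsilon> \<le> vnorm (Z i) (x i \<oplus>\<^bsub>Z i\<^esub> y i)}
          \<subseteq> {i. \<epsilon> / 2 \<le> vnorm (Z i) (x i)} \<union> {i. \<epsilon> / 2 \<le> vnorm (Z i) (y i)}"
        by blast
    qed
    then show "x \<oplus>\<^bsub>linf Z\<^esub> y \<in> c0 I Z"
      using x y unfolding c0_iff by (simp add: linf_add_closed) (simp add: linf_add)
  next
    fix x and a :: real assume "x \<in> c0 I Z"
    then have x: "x \<in> carrier (linf Z)" "\<And>\<epsilon>. \<epsilon> > 0 \<Longrightarrow> {i. \<epsilon> \<le> vnorm (Z i) (x i)} \<in> I"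
      by (simp_all add: c0_iff)
    have "{i. \<epsilon> \<le> vnorm (Z i) (a \<odot>\<^bsub>Z i\<^esub> x i)} \<in> I" if "\<epsilon> > 0" for \<epsilon>
    proof (rule sub)
      \<comment> \<open>Adding 1 keeps the divisor positive, so that \<open>a = 0\<close> needs no
        separate case.\<close>
      show "{i. \<epsilon> / (\<bar>a\<bar> + 1) \<le> vnorm (Z i) (x i)} \<in> I"
        using that by (intro x(2)) simp
      have "\<epsilon> / (\<bar>a\<bar> + 1) \<le> vnorm (Z i) (x i)" if "\<epsilon> \<le> vnorm (Z i) (a \<odot>\<^bsub>Z i\<^esub> x i)" for i
      proof -
        have "\<epsilon> \<le> \<bar>a\<bar> * vnorm (Z i) (x i)"
          using that Z.norm_scale_le[of "x i" i a] x by (simp add: linf_component)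
        then have "\<epsilon> \<le> (\<bar>a\<bar> + 1) * vnorm (Z i) (x i)"
          using Z.norm_nonneg[of "x i" i] x by (simp add: linf_component distrib_right)
        then show ?thesis
          by (simp add: divide_le_eq mult.commute add_nonneg_pos)
      qed
      then show "{i. \<epsilon> \<le> vnorm (Z i) (a \<odot>\<^bsub>Z i\<^esub> x i)} \<subseteq> {i. \<epsilon> / (\<bar>a\<bar> + 1) \<le> vnorm (Z i) (x i)}"
        by blast
    qed
    then show "a \<odot>\<^bsub>linf Z\<^esub> x \<in> c0 I Z"
      using x unfolding c0_iff by (simp add: linf_scale_closed) (simp add: linf_scale)
  next
    fix x assume x: "x \<in> c0 I Z"
    then have c: "x \<in> carrier (linf Z)"
      by (simp add: c0_iff)
    show "vabs\<^bsub>linf Z\<^esub> x \<in> c0 I Z"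
    proof (rule c0_dominated[OF I _ x])
      show "vnorm (Z i) ((vabs\<^bsub>linf Z\<^esub> x) i) \<le> vnorm (Z i) (x i)" for i
        using c by (simp add: linf_vabs linf_component Z.norm_vabs_le)
    qed (use c in simp)
  next
    fix x y assume x: "x \<in> carrier (linf Z)" and y: "y \<in> c0 I Z"
      and le: "x \<sqsubseteq>\<^bsub>linf Z\<^esub> y" "(- 1) \<odot>\<^bsub>linf Z\<^esub> x \<sqsubseteq>\<^bsub>linf Z\<^esub> y"
    show "x \<in> c0 I Z"
    proof (rule c0_dominated[OF I x y])
      show "vnorm (Z i) (x i) \<le> vnorm (Z i) (y i)" for i
        using x y le by (simp add: c0_iff linf_le linf_scale linf_component Z.norm_le)
    qed
  qed
qed

text \<open>If the norm is at most \<open>c\<close>, a nearly optimal correction \<open>j\<close>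
  must itself be large wherever \<open>x\<close> exceeds \<open>c + \<epsilon>\<close>, and it is
  large only on a set of \<open>I\<close>. Conversely, cancelling \<open>x\<close> on the
  exceptional set costs only an element of \<open>c0 I Z\<close> and leaves a family bounded by
  \<open>c + \<epsilon>\<close>.\<close>

lemma c0_quot_norm_le_iff:
  assumes I: "set_ideal I" and x: "x \<in> carrier (linf Z)" and c: "0 \<le> c"
  shows "vnorm (linf Z //\<^sub>q c0 I Z) (coset (linf Z) (c0 I Z) x) \<le> c \<longleftrightarrow>
    (\<forall>\<epsilon>>0. {i. c + \<epsilon> \<le> vnorm (Z i) (x i)} \<in> I)"
proof -
  interpret C: vlat_ideal "linf Z" "c0 I Z"
    by (rule vlat_ideal_c0[OF I])
  have sub: "A \<in> I" if "A \<subseteq> B" "B \<in> I" for A B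
    using I that unfolding set_ideal_def by blast
  show ?thesis
  proof (intro iffI allI impI)
    fix \<epsilon> :: real
    assume le: "vnorm (linf Z //\<^sub>q c0 I Z) (C.\<pi> x) \<le> c" and \<epsilon>: "\<epsilon> > 0"
    then have "vnorm (linf Z //\<^sub>q c0 I Z) (C.\<pi> x) < c + \<epsilon> / 2"
      by simp
    then obtain j where j: "j \<in> c0 I Z" "vnorm (linf Z) (x \<oplus>\<^bsub>linf Z\<^esub> j) < c + \<epsilon> / 2"
      by (rule C.quot_norm_less[OF x])
    \<comment> \<open>Reverse triangle inequality, from writing \<open>x i\<close> as the corrected
      coordinate minus \<open>j i\<close>.\<close>
    have "\<epsilon> / 2 \<le> vnorm (Z i) (j i)" if i: "c + \<epsilon> \<le> vnorm (Z i) (x i)" for i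
    proof -
      have ij: "x i \<in> carrier (Z i)" "j i \<in> carrier (Z i)"
        using x j by (simp_all add: linf_component)
      have "x i \<oplus>\<^bsub>Z i\<^esub> j i \<oplus>\<^bsub>Z i\<^esub> (- 1) \<odot>\<^bsub>Z i\<^esub> j i = x i"
        using ij by (simp add: Z.add_assoc)
      then have "vnorm (Z i) (x i) \<le> vnorm (Z i) (x i \<oplus>\<^bsub>Z i\<^esub> j i) + vnorm (Z i) ((- 1) \<odot>\<^bsub>Z i\<^esub> j i)"
        using ij Z.norm_triangle[of "x i \<oplus>\<^bsub>Z i\<^esub> j i" i "(- 1) \<odot>\<^bsub>Z i\<^esub> j i"] by simp
      moreover have "vnorm (Z i) ((- 1) \<odot>\<^bsub>Z i\<^esub> j i) \<le> vnorm (Z i) (j i)"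
        using ij by (simp add: Z.norm_neg_le)
      moreover have "vnorm (Z i) ((x \<oplus>\<^bsub>linf Z\<^esub> j) i) \<le> vnorm (linf Z) (x \<oplus>\<^bsub>linf Z\<^esub> j)"
        using x j by (intro linf_component_norm_le) simp
      moreover have "(x \<oplus>\<^bsub>linf Z\<^esub> j) i = x i \<oplus>\<^bsub>Z i\<^esub> j i"
        by (simp add: linf_add)
      ultimately show ?thesis
        using i j(2) by simp
    qed
    then have "{i. c + \<epsilon> \<le> vnorm (Z i) (x i)} \<subseteq> {i. \<epsilon> / 2 \<le> vnorm (Z i) (j i)}"
      by blast
    moreover have "{i. \<epsilon> / 2 \<le> vnorm (Z i) (j i)} \<in> I"
      using j(1) half_gt_zero[OF \<epsilon>] unfolding c0_iff by blast
    ultimately show "{i. c + \<epsilon> \<le> vnorm (Z i) (x i)} \<in> I"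
      by (rule sub)
  next
    assume *: "\<forall>\<epsilon>>0. {i. c + \<epsilon> \<le> vnorm (Z i) (x i)} \<in> I"
    show "vnorm (linf Z //\<^sub>q c0 I Z) (C.\<pi> x) \<le> c"
    proof (rule field_le_epsilon)
      fix \<epsilon> :: real assume \<epsilon>: "\<epsilon> > 0"
      define A where "A = {i. c + \<epsilon> \<le> vnorm (Z i) (x i)}"
      \<comment> \<open>The corrected family vanishes on \<open>A\<close> and agrees with
        \<open>x\<close> off \<open>A\<close>, where the norm is below
        \<open>c + \<epsilon>\<close>. On \<open>A\<close> the bound holds because \<open>c\<close>
        is nonnegative.\<close>
      define j where "j i = (if i \<in> A then (- 1) \<odot>\<^bsub>Z i\<^esub> x i else \<zero>\<^bsub>Z i\<^esub>)" for i
      have jl: "j \<in> carrier (linf Z)"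
      proof (rule linf_carrierI)
        show "vnorm (Z i) (j i) \<le> vnorm (linf Z) x" for i
          using Z.norm_neg_le[of "x i" i] linf_component_norm_le[OF x, of i] x
            Z.norm_nonneg[of "x i" i]
          by (simp add: j_def linf_component)
      qed (use x in \<open>simp add: j_def linf_component\<close>)
      \<comment> \<open>One set of \<open>I\<close> serves every threshold: \<open>j\<close> is zero
        outside \<open>A\<close>, so it can reach a positive norm only inside.\<close>
      have "i \<in> A" if "\<delta> > 0" "\<delta> \<le> vnorm (Z i) (j i)" for i \<delta>
        using that by (cases "i \<in> A") (simp_all add: j_def)
      then have "{i. \<delta> \<le> vnorm (Z i) (j i)} \<subseteq> A" if "\<delta> > 0" for \<delta>
        using that by blast
      moreover have "A \<in> I"
        using * \<epsilon> by (simp add: A_def)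
      ultimately have "j \<in> c0 I Z"
        using jl sub unfolding c0_iff by blast
      then have "vnorm (linf Z //\<^sub>q c0 I Z) (C.\<pi> x) \<le> vnorm (linf Z) (x \<oplus>\<^bsub>linf Z\<^esub> j)"
        by (rule C.quot_norm_le[OF x])
      also have "\<dots> \<le> c + \<epsilon>"
      proof (rule linf_norm_le_iff[THEN iffD2, rule_format])
        show "vnorm (Z i) ((x \<oplus>\<^bsub>linf Z\<^esub> j) i) \<le> c + \<epsilon>" for i
          using x c \<epsilon> by (cases "i \<in> A") (simp_all add: linf_add j_def linf_component, simp add: A_def)
      qed (use x jl in simp)
      finally show "vnorm (linf Z //\<^sub>q c0 I Z) (C.\<pi> x) \<le> c + \<epsilon>" .
    qed
  qed
qed

end

section \<open>Iterated quotients\<close>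

text \<open>The set \<open>?bad A\<close> of rows lying outside their ideals is monotone in
  \<open>A\<close> and subadditive under unions, and it is empty for finite \<open>A\<close>, whose
  rows are finite. The ideal properties of \<open>I\<close> then transfer.\<close>

lemma set_ideal_frolik_sum:
  assumes I: "set_ideal I" and Is: "\<And>n. set_ideal (Is n)"
  shows "set_ideal (frolik_sum I Is)"
proof -
  let ?bad = "\<lambda>A. {m. {n. (m, n) \<in> A} \<notin> Is m}"
  have sub: "A \<in> I" if "A \<subseteq> B" "B \<in> I" for A B
    using I that unfolding set_ideal_def by blast
  have Is_sub: "A \<in> Is m" if "A \<subseteq> B" "B \<in> Is m" for A B m
    using Is[of m] that unfolding set_ideal_def by blast
  have fin: "?bad A = {}" if "finite A" for A
  proof -
    have "{n. (m, n) \<in> A} \<subseteq> snd ` A" for m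
      by force
    then have "finite {n. (m, n) \<in> A}" for m
      using that finite_subset by blast
    then show ?thesis
      using Is by (simp add: set_ideal_def)
  qed
  show ?thesis
    unfolding set_ideal_def
  proof (intro conjI ballI allI impI)
    fix A B assume A: "A \<in> frolik_sum I Is" and "B \<subseteq> A"
    then have "{n. (m, n) \<in> B} \<subseteq> {n. (m, n) \<in> A}" for m
      by blast
    then have "?bad B \<subseteq> ?bad A"
      using Is_sub by blast
    with A show "B \<in> frolik_sum I Is"
      using sub by (simp add: frolik_sum_def)
  next
    fix A B assume AB: "A \<in> frolik_sum I Is" "B \<in> frolik_sum I Is"
    have "{n. (m, n) \<in> A \<union> B} = {n. (m, n) \<in> A} \<union> {n. (m, n) \<in> B}" for m
      by blast
    then have "?bad (A \<union> B) \<subseteq> ?bad A \<union> ?bad B"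
      using Is by (auto simp: set_ideal_def)
    moreover have "?bad A \<union> ?bad B \<in> I"
      using AB I by (simp add: frolik_sum_def set_ideal_def)
    ultimately show "A \<union> B \<in> frolik_sum I Is"
      using sub by (simp add: frolik_sum_def)
  next
    have "{} \<in> I"
      using I by (simp add: set_ideal_def)
    then show "A \<in> frolik_sum I Is" if "finite A" for A
      using fin[OF that] by (simp add: frolik_sum_def)
    then show "{} \<in> frolik_sum I Is"
      by blast
  qed
qed

text \<open>The factorization lemma is applied to \<open>\<Psi>\<close> followed by the class map of
  \<open>c0 I Q\<close>. Kernel and norm both come from the equivalence \<open>key\<close>: the
  kernel from its case \<open>c = 0\<close>, the norm from all nonnegative \<open>c\<close>.\<close>

lemma frolik_quot_isometric:
  fixes X :: "'a normed_vlat"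
  assumes I: "set_ideal I" and Is: "\<And>n. set_ideal (Is n)" and X: "seminormed_vlat X"
  shows "linf (\<lambda>_::nat \<times> nat. X) //\<^sub>q c0 (frolik_sum I Is) (\<lambda>_. X)
    \<equiv>\<^sub>\<le> linf (\<lambda>n. linf (\<lambda>_::nat. X) //\<^sub>q c0 (Is n) (\<lambda>_. X))
          //\<^sub>q c0 I (\<lambda>n. linf (\<lambda>_::nat. X) //\<^sub>q c0 (Is n) (\<lambda>_. X))"
proof -
  interpret X: seminormed_vlat X by fact
  interpret P: vlat_family "\<lambda>_::nat \<times> nat. X" by unfold_locales
  interpret L: vlat_family "\<lambda>_::nat. X" by unfold_locales
  let ?F = "frolik_sum I Is"
  let ?P = "linf (\<lambda>_::nat \<times> nat. X)"
  let ?L = "linf (\<lambda>_::nat. X)"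
  define Q where "Q n = ?L //\<^sub>q c0 (Is n) (\<lambda>_. X)" for n
  have F: "set_ideal ?F"
    by (rule set_ideal_frolik_sum[OF I Is])
  interpret PF: vlat_ideal ?P "c0 ?F (\<lambda>_. X)"
    by (rule P.vlat_ideal_c0[OF F])
  interpret LI: vlat_ideal ?L "c0 (Is n) (\<lambda>_. X)" for n
    by (rule L.vlat_ideal_c0[OF Is])
  interpret Q: vlat_family Q
    by (rule vlat_family.intro) (simp add: Q_def LI.seminormed_vlat_quot)
  interpret QI: vlat_ideal "linf Q" "c0 I Q"
    by (rule Q.vlat_ideal_c0[OF I])
  define \<Psi> where "\<Psi> x = (\<lambda>m. LI.\<pi> m (\<lambda>n. x (m, n)))" for x :: "nat \<times> nat \<Rightarrow> 'a"
  have row: "(\<lambda>n. x (m, n)) \<in> carrier ?L" if "x \<in> carrier ?P" for x m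
    using that P.linf_component_norm_le[OF that] by (intro L.linf_carrierI P.linf_component) auto
  have \<Psi>: "\<Psi> x \<in> carrier (linf Q)" if x: "x \<in> carrier ?P" for x
  proof (rule Q.linf_carrierI)
    fix m
    show "\<Psi> x m \<in> carrier (Q m)"
      using row[OF x] by (simp add: Q_def \<Psi>_def LI.quot_carrier)
    have "vnorm (Q m) (\<Psi> x m) \<le> vnorm ?L (\<lambda>n. x (m, n))"
      using LI.quot_norm_le[OF row[OF x] LI.ideal_zero, of m m] row[OF x, of m]
      by (simp add: Q_def \<Psi>_def)
    also have "\<dots> \<le> vnorm ?P x"
      using row[OF x, of m] P.linf_component_norm_le[OF x] by (simp add: L.linf_norm_le_iff)
    finally show "vnorm (Q m) (\<Psi> x m) \<le> vnorm ?P x" .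
  qed
  have \<Psi>_add: "\<Psi> (x \<oplus>\<^bsub>?P\<^esub> y) = \<Psi> x \<oplus>\<^bsub>linf Q\<^esub> \<Psi> y" if "x \<in> carrier ?P" "y \<in> carrier ?P" for x y
    using row that by (simp add: \<Psi>_def Q.linf_add P.linf_add Q_def LI.quot_add) (simp add: L.linf_add)
  have \<Psi>_scale: "\<Psi> (a \<odot>\<^bsub>?P\<^esub> x) = a \<odot>\<^bsub>linf Q\<^esub> \<Psi> x" if "x \<in> carrier ?P" for a x
    using row that by (simp add: \<Psi>_def Q.linf_scale P.linf_scale Q_def LI.quot_scale) (simp add: L.linf_scale)
  have \<Psi>_join: "\<Psi> (x \<squnion>\<^bsub>?P\<^esub> y) = \<Psi> x \<squnion>\<^bsub>linf Q\<^esub> \<Psi> y" if "x \<in> carrier ?P" "y \<in> carrier ?P" for x y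
    using row that \<Psi>
    by (simp add: Q.linf_join P.linf_join) (simp add: \<Psi>_def Q_def LI.quot_join L.linf_join)
  have Is_sub: "A \<in> Is m" if "A \<subseteq> B" "B \<in> Is m" for A B m
    using Is[of m] that unfolding set_ideal_def by blast
  have I_sub: "A \<in> I" if "A \<subseteq> B" "B \<in> I" for A B
    using I that unfolding set_ideal_def by blast
  have norm_le_iff: "vnorm (Q m) (\<Psi> x m) \<le> c \<longleftrightarrow> (\<forall>\<epsilon>>0. {n. c + \<epsilon> \<le> vnorm X (x (m, n))} \<in> Is m)"
    if "x \<in> carrier ?P" "0 \<le> c" for x m c
    using L.c0_quot_norm_le_iff[OF Is row[OF that(1)] that(2)] by (simp add: Q_def \<Psi>_def)
  \<comment> \<open>Both sides are norm criteria, for the sequence of row classes along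
    \<open>I\<close> and for the double family along the Frolik sum. The rows of large class norm
    and the rows whose level set escapes \<open>Is m\<close> contain each other once the threshold
    is lowered by \<open>\<epsilon> / 2\<close>.\<close>
  have key: "(\<forall>\<epsilon>>0. {m. c + \<epsilon> \<le> vnorm (Q m) (\<Psi> x m)} \<in> I) \<longleftrightarrow>
      (\<forall>\<epsilon>>0. {p. c + \<epsilon> \<le> vnorm X (x p)} \<in> ?F)" (is "?lhs \<longleftrightarrow> ?rhs")
    if x: "x \<in> carrier ?P" and c: "0 \<le> c" for x c
  proof (intro iffI allI impI)
    fix \<epsilon> :: real assume l: ?lhs and \<epsilon>: "\<epsilon> > 0"
    have "{n. c + \<epsilon> \<le> vnorm X (x (m, n))} \<in> Is m" if "\<not> c + \<epsilon> / 2 \<le> vnorm (Q m) (\<Psi> x m)" for m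
    proof -
      have "vnorm (Q m) (\<Psi> x m) \<le> c + \<epsilon> / 2"
        using that by simp
      then have "\<forall>\<delta>>0. {n. c + \<epsilon> / 2 + \<delta> \<le> vnorm X (x (m, n))} \<in> Is m"
        using norm_le_iff[OF x, of "c + \<epsilon> / 2" m] c \<epsilon> by simp
      from this[rule_format, of "\<epsilon> / 2"] show ?thesis
        using \<epsilon> by (simp add: add.assoc)
    qed
    then have "{m. {n. c + \<epsilon> \<le> vnorm X (x (m, n))} \<notin> Is m} \<subseteq> {m. c + \<epsilon> / 2 \<le> vnorm (Q m) (\<Psi> x m)}"
      by blast
    then have "{m. {n. c + \<epsilon> \<le> vnorm X (x (m, n))} \<notin> Is m} \<in> I"
      using l \<epsilon> half_gt_zero I_sub by blast
    then show "{p. c + \<epsilon> \<le> vnorm X (x p)} \<in> ?F"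
      by (simp add: frolik_sum_def)
  next
    fix \<epsilon> :: real assume r: ?rhs and \<epsilon>: "\<epsilon> > 0"
    \<comment> \<open>Were this level set in \<open>Is m\<close>, all higher ones would be too, and
      the class of the row would have norm at most \<open>c + \<epsilon> / 2\<close>.\<close>
    have "{n. c + \<epsilon> / 2 \<le> vnorm X (x (m, n))} \<notin> Is m" if m: "c + \<epsilon> \<le> vnorm (Q m) (\<Psi> x m)" for m
    proof
      assume *: "{n. c + \<epsilon> / 2 \<le> vnorm X (x (m, n))} \<in> Is m"
      have "{n. (c + \<epsilon> / 2) + \<delta> \<le> vnorm X (x (m, n))} \<in> Is m" if "\<delta> > 0" for \<delta>
        by (rule Is_sub[OF _ *]) (use that in auto)
      then have "vnorm (Q m) (\<Psi> x m) \<le> c + \<epsilon> / 2"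
        using norm_le_iff[OF x, of "c + \<epsilon> / 2" m] c \<epsilon> by simp
      with m \<epsilon> show False
        by simp
    qed
    then have "{m. c + \<epsilon> \<le> vnorm (Q m) (\<Psi> x m)} \<subseteq> {m. {n. c + \<epsilon> / 2 \<le> vnorm X (x (m, n))} \<notin> Is m}"
      by blast
    moreover have "{m. {n. c + \<epsilon> / 2 \<le> vnorm X (x (m, n))} \<notin> Is m} \<in> I"
      using r half_gt_zero[OF \<epsilon>] by (auto simp: frolik_sum_def)
    ultimately show "{m. c + \<epsilon> \<le> vnorm (Q m) (\<Psi> x m)} \<in> I"
      by (rule I_sub)
  qed
  have \<Psi>_c0: "\<Psi> x \<in> c0 I Q \<longleftrightarrow> x \<in> c0 ?F (\<lambda>_. X)" if x: "x \<in> carrier ?P" for x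
    using key[OF x, of 0] \<Psi>[OF x] x by (simp add: Q.c0_iff P.c0_iff)
  have norm: "vnorm (linf Q //\<^sub>q c0 I Q) (QI.\<pi> (\<Psi> x)) = vnorm (?P //\<^sub>q c0 ?F (\<lambda>_. X)) (PF.\<pi> x)"
    (is "?a = ?b") if x: "x \<in> carrier ?P" for x
  proof -
    \<comment> \<open>Two nonnegative numbers with the same nonnegative upper bounds coincide; each
      is inserted for \<open>c\<close> in turn.\<close>
    have iff: "?a \<le> c \<longleftrightarrow> ?b \<le> c" if "0 \<le> c" for c
      using key[OF x that] Q.c0_quot_norm_le_iff[OF I \<Psi>[OF x] that] P.c0_quot_norm_le_iff[OF F x that]
      by simp
    have "0 \<le> ?a" "0 \<le> ?b"
      using x \<Psi>[OF x] seminormed_vlat.norm_nonneg[OF QI.seminormed_vlat_quot]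
        seminormed_vlat.norm_nonneg[OF PF.seminormed_vlat_quot]
      by (simp_all add: QI.quot_carrier PF.quot_carrier)
    with iff[of ?a] iff[of ?b] show ?thesis
      by simp
  qed
  have "?P //\<^sub>q c0 ?F (\<lambda>_. X) \<equiv>\<^sub>\<le> linf Q //\<^sub>q c0 I Q"
  proof (rule lattice_isometric_quotI[where \<Phi> = "\<lambda>x. QI.\<pi> (\<Psi> x)"])
    show "(\<lambda>x. QI.\<pi> (\<Psi> x)) ` carrier ?P = carrier (linf Q //\<^sub>q c0 I Q)"
    proof (intro equalityI subsetI)
      fix A assume "A \<in> carrier (linf Q //\<^sub>q c0 I Q)"
      then obtain q where q: "q \<in> carrier (linf Q)" "A = QI.\<pi> q"
        by (auto simp: QI.quot_carrier)
      \<comment> \<open>Each row class is lifted separately; the common slack of 1 bounds all lifted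
        rows by the norm of \<open>q\<close> plus 1, so they assemble to a bounded double
        family.\<close>
      have "\<exists>y. y \<in> carrier ?L \<and> q m = LI.\<pi> m y \<and> vnorm ?L y \<le> vnorm (Q m) (q m) + 1" for m
        using LI.quot_representative[of "q m" m] Q.linf_component[OF q(1), of m]
        unfolding Q_def by metis
      then obtain y where y: "\<And>m. y m \<in> carrier ?L" "\<And>m. q m = LI.\<pi> m (y m)"
        "\<And>m. vnorm ?L (y m) \<le> vnorm (Q m) (q m) + 1"
        by metis
      define x where "x = (\<lambda>(m, n). y m n)"
      have "vnorm X (y m n) \<le> vnorm (linf Q) q + 1" for m n
        using L.linf_component_norm_le[OF y(1), of m n] y(3)[of m] Q.linf_component_norm_le[OF q(1), of m]
        by linarith
      then have "x \<in> carrier ?P"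
        using L.linf_component[OF y(1)] by (intro P.linf_carrierI) (auto simp: x_def)
      moreover have "\<Psi> x = q"
        by (rule ext) (simp add: \<Psi>_def x_def y(2))
      ultimately show "A \<in> (\<lambda>x. QI.\<pi> (\<Psi> x)) ` carrier ?P"
        using q(2) by blast
    qed (auto simp: QI.quot_carrier \<Psi>)
  next
    fix x y assume xy: "x \<in> carrier ?P" "y \<in> carrier ?P"
    then show "QI.\<pi> (\<Psi> x) = QI.\<pi> (\<Psi> y) \<longleftrightarrow> PF.\<pi> x = PF.\<pi> y"
      \<comment> \<open>Equality of classes means that a difference lies in the ideal. By linearity
        the difference of the images is the image of the difference, to which
        \<open>\<Psi>_c0\<close> applies.\<close>
      by (simp add: QI.coset_eq_iff PF.coset_eq_iff \<Psi> \<Psi>_c0 flip: \<Psi>_add \<Psi>_scale)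
  qed (simp_all add: PF.vlat_ideal_axioms QI.lattice_quot QI.quot_add QI.quot_scale QI.quot_join
      \<Psi> \<Psi>_add \<Psi>_scale \<Psi>_join norm)
  then show ?thesis
    by (simp add: Q_def[abs_def])
qed

theorem theorem8p5:
  fixes I :: "nat set set" and Is :: "nat \<Rightarrow> nat set set" and X :: "'a normed_vlat"
  assumes "set_ideal I" and "\<And>n. proper_ideal (Is n)" and "banach_lattice X"
  shows
    "(linf (\<lambda>_::nat \<times> nat. X) //\<^sub>q c0 (frolik_sum I Is) (\<lambda>_. X)
        \<equiv>\<^sub>\<le> linf (\<lambda>n. linf (\<lambda>_::nat. X) //\<^sub>q c0 (Is n) (\<lambda>_. X))
            //\<^sub>q c0 I (\<lambda>n. linf (\<lambda>_::nat. X) //\<^sub>q c0 (Is n) (\<lambda>_. X))) \<and>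
     (\<forall>J. (\<forall>n. Is n = J) \<longrightarrow>
        linf (\<lambda>_::nat \<times> nat. X) //\<^sub>q c0 (fubini_product I J) (\<lambda>_. X)
        \<equiv>\<^sub>\<le> linf (\<lambda>_::nat. linf (\<lambda>_::nat. X) //\<^sub>q c0 J (\<lambda>_. X))
            //\<^sub>q c0 I (\<lambda>_. linf (\<lambda>_::nat. X) //\<^sub>q c0 J (\<lambda>_. X)))"
proof -
  have *: "linf (\<lambda>_::nat \<times> nat. X) //\<^sub>q c0 (frolik_sum I Is) (\<lambda>_. X)
      \<equiv>\<^sub>\<le> linf (\<lambda>n. linf (\<lambda>_::nat. X) //\<^sub>q c0 (Is n) (\<lambda>_. X))
          //\<^sub>q c0 I (\<lambda>n. linf (\<lambda>_::nat. X) //\<^sub>q c0 (Is n) (\<lambda>_. X))"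
    using assms by (intro frolik_quot_isometric banach_lattice.seminormed_vlat)
      (simp_all add: proper_ideal_def)
  \<comment> \<open>As functions the two sequences are equal, and the Fubini product is by
    definition the Frolik sum of the constant sequence.\<close>
  moreover have "Is = (\<lambda>_. J)" if "\<forall>n. Is n = J" for J
    using that by blast
  ultimately show ?thesis
    by (auto simp: fubini_product_def)
qed

end
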